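(* Let $\mathscr{C}$ be an $\mathbf{Ord}$-enriched category, $\mathcal{S}$ a class of subobjects, and $\mathcal{P}(\mathscr{C})$ the $\mathbf{Ord}$-enriched category of partial maps with the order $\le$. For a partial map $f=(\sigma_f,\varphi_f):A\to B$ put $Kf=D_f$, $Lf=(\sigma_f,\mathrm{id}_{D_f}):A\to D_f$ and $Rf=(\mathrm{id}_{D_f},\varphi_f):D_f\to B$. For a lax square $(u,v):f\to g$ in $\mathcal{P}(\mathscr{C})$ let $K(u,v):D_f\to D_g$ be the partial map with partial domain $D_{g\cdot u}$, whose left component is the composite $D_{g\cdot u}\rightarrowtail D_{v\cdot f}\rightarrowtail D_f$ (the first map being the one witnessing $g\cdot u\le v\cdot f$) and whose right component is the pullback $\sigma_g^*(\varphi_u):D_{g\cdot u}\to D_g$ of $\varphi_u$ along $\sigma_g$. Then these data define a lax functorial factorisation system on $\mathcal{P}(\mathscr{C})$, it is predistributive, and $(\mathbf{PLA},\mathbf{Tot})$ is a lax weak factorisation system on $\mathcal{P}(\mathscr{C})$ underlying it (so $Lf\in\mathbf{PLA}$ and $Rf\in\mathbf{Tot}$ for all $f$). Here $\mathbf{Tot}$ is the class of total partial maps and $\mathbf{PLA}$ is the class of partial maps $f$ such that $\varphi_f=\sigma\cdot\overline{\varphi}$ with $\sigma\in\mathcal{S}$ and $\overline{\varphi}$ a left adjoint in $\mathscr{C}$.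
   Context: An $\mathbf{Ord}$-enriched category is a category whose hom-sets are partially ordered with monotone composition. An adjunction $p\dashv q$, for $p:A\to B$, $q:B\to A$, means $\mathrm{id}_A\le q\cdot p$ and $p\cdot q\le\mathrm{id}_B$; then $p$ is called a left adjoint. Partial maps: the order of $\mathscr{C}$ is denoted $\sqsubseteq$. $\mathcal{S}$ is a class of monomorphisms of $\mathscr{C}$ closed under composition, stable under pullback and containing all sections (split monomorphisms); $\mathscr{C}$ has pullbacks along morphisms in $\mathcal{S}$; every $s\in\mathcal{S}$ is full, i.e. $s\cdot a\sqsubseteq s\cdot b$ implies $a\sqsubseteq b$. $\mathcal{P}(\mathscr{C})$ has the objects of $\mathscr{C}$; a morphism (partial map) $f:A\to B$ is a span $(\sigma_f,\varphi_f)$ with $\sigma_f:D_f\rightarrowtail A$ in $\mathcal{S}$ and $\varphi_f:D_f\to B$ in $\mathscr{C}$ (spans being identified up to isomorphism). The composite $g\cdot f$ has $D_{g\cdot f}$ the pullback of $\sigma_g$ along $\varphi_f$, $\sigma_{g\cdot f}=\sigma_f\cdot\varphi_f^*(\sigma_g)$, $\varphi_{g\cdot f}=\varphi_g\cdot\sigma_g^*(\varphi_f)$. The order is: $f\le g$ iff there is $s:D_f\rightarrowtail D_g$ in $\mathcal{S}$ with $\sigma_f=\sigma_g\cdot s$ and $\varphi_f\sqsubseteq\varphi_g\cdot s$. It is assumed that with this order $\mathcal{P}(\mathscr{C})$ is $\mathbf{Ord}$-enriched (composition is monotone). $f$ is total if its partial domain $D_f$ is its whole domain ($\sigma_f$ is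 an isomorphism). In an $\mathbf{Ord}$-enriched category: a lax square $(u,v):f\to g$ is a pair with $g\cdot u\le v\cdot f$; lax squares are the morphisms of the lax arrow category. $f\perp_{\mathrm{lax}}g$ means that for every lax square $(u,v):f\to g$ there is $d:\mathrm{cod}(f)\to\mathrm{dom}(g)$ with $u\le d\cdot f$ and $g\cdot d\le v$. A lax weak factorisation system is a pair $(\mathcal{L},\mathcal{R})$ with $\mathcal{R}=\{g\mid f\perp_{\mathrm{lax}}g\ \forall f\in\mathcal{L}\}$, $\mathcal{L}=\{f\mid f\perp_{\mathrm{lax}}g\ \forall g\in\mathcal{R}\}$ such that every morphism factors as $r\cdot l$ with $l\in\mathcal{L}$, $r\in\mathcal{R}$. A lax functorial factorisation system assigns to each $f:A\to B$ morphisms $Lf:A\to Kf$, $Rf:Kf\to B$ with $Rf\cdot Lf=f$ and to each lax square $(u,v):f\to g$ a morphism $K(u,v):Kf\to Kg$ with $Lg\cdot u\le K(u,v)\cdot Lf$ and $Rg\cdot K(u,v)\le v\cdot Rf$, preserving identities and composition of lax squares. It is predistributive if $Lf\perp_{\mathrm{lax}}RLf$ and $LRf\perp_{\mathrm{lax}}Rf$ for every $f$. A lax weak factorisation system $(\mathcal{L},\mathcal{R})$ underlies it if $Lf\in\mathcal{L}$ and $Rf\in\mathcal{R}$ for every $f$. *)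

theory Defs
  imports Main
begin

section \<open>Ord-enriched categories\<close>

text \<open>\<open>g \<cdot> f\<close> is ``first \<open>f\<close>, then \<open>g\<close>''; it is only meaningful for \<open>tgt f = src g\<close>.\<close>

record ('o, 'm) ocat =
  Obj :: "'o set"
  Arr :: "'m set"
  src :: "'m \<Rightarrow> 'o"
  tgt :: "'m \<Rightarrow> 'o"
  ide :: "'o \<Rightarrow> 'm"
  compose :: "'m \<Rightarrow> 'm \<Rightarrow> 'm"  (infixl "\<cdot>\<index>" 70)
  leq :: "'m \<Rightarrow> 'm \<Rightarrow> bool"  (infix "\<sqsubseteq>\<index>" 50)

definition hom :: "('o, 'm) ocat \<Rightarrow> 'o \<Rightarrow> 'o \<Rightarrow> 'm set" where
  "hom C A B = {f \<in> Arr C. src C f = A \<and> tgt C f = B}"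

definition monotone_composition :: "('o, 'm) ocat \<Rightarrow> bool" where
  "monotone_composition C \<longleftrightarrow>
     (\<forall>f f' g g'. f \<sqsubseteq>\<^bsub>C\<^esub> f' \<and> g \<sqsubseteq>\<^bsub>C\<^esub> g' \<and> tgt C f = src C g
        \<longrightarrow> g \<cdot>\<^bsub>C\<^esub> f \<sqsubseteq>\<^bsub>C\<^esub> g' \<cdot>\<^bsub>C\<^esub> f')"

locale ord_category =
  fixes C :: "('o, 'm) ocat" (structure)
  assumes src_Obj: "f \<in> Arr C \<Longrightarrow> src C f \<in> Obj C"
    and tgt_Obj: "f \<in> Arr C \<Longrightarrow> tgt C f \<in> Obj C"
    and ide_hom: "A \<in> Obj C \<Longrightarrow> ide C A \<in> hom C A A"
    and compose_hom: "\<lbrakk>f \<in> hom C A B; g \<in> hom C B D\<rbrakk> \<Longrightarrow> g \<cdot> f \<in> hom C A D"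
    and ide_right: "f \<in> hom C A B \<Longrightarrow> f \<cdot> ide C A = f"
    and ide_left: "f \<in> hom C A B \<Longrightarrow> ide C B \<cdot> f = f"
    and assoc: "\<lbrakk>f \<in> hom C A B; g \<in> hom C B D; h \<in> hom C D E\<rbrakk>
        \<Longrightarrow> (h \<cdot> g) \<cdot> f = h \<cdot> (g \<cdot> f)"
    and leq_parallel: "f \<sqsubseteq> g \<Longrightarrow> \<exists>A B. f \<in> hom C A B \<and> g \<in> hom C A B"
    and leq_refl: "f \<in> Arr C \<Longrightarrow> f \<sqsubseteq> f"
    and leq_antisym: "\<lbrakk>f \<sqsubseteq> g; g \<sqsubseteq> f\<rbrakk> \<Longrightarrow> f = g"
    and leq_trans: "\<lbrakk>f \<sqsubseteq> g; g \<sqsubseteq> h\<rbrakk> \<Longrightarrow> f \<sqsubseteq> h"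
    and compose_mono: "monotone_composition C"

definition monic :: "('o, 'm) ocat \<Rightarrow> 'm \<Rightarrow> bool" where
  "monic C m \<longleftrightarrow> m \<in> Arr C \<and>
     (\<forall>X. \<forall>a \<in> hom C X (src C m). \<forall>b \<in> hom C X (src C m).
        m \<cdot>\<^bsub>C\<^esub> a = m \<cdot>\<^bsub>C\<^esub> b \<longrightarrow> a = b)"

definition split_monic :: "('o, 'm) ocat \<Rightarrow> 'm \<Rightarrow> bool" where
  "split_monic C m \<longleftrightarrow> m \<in> Arr C \<and>
     (\<exists>r \<in> hom C (tgt C m) (src C m). r \<cdot>\<^bsub>C\<^esub> m = ide C (src C m))"

definition iso :: "('o, 'm) ocat \<Rightarrow> 'm \<Rightarrow> bool" where
  "iso C i \<longleftrightarrow> i \<in> Arr C \<and>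
     (\<exists>j \<in> hom C (tgt C i) (src C i).
        j \<cdot>\<^bsub>C\<^esub> i = ide C (src C i) \<and> i \<cdot>\<^bsub>C\<^esub> j = ide C (tgt C i))"

definition left_adjoint :: "('o, 'm) ocat \<Rightarrow> 'm \<Rightarrow> bool" where
  "left_adjoint C p \<longleftrightarrow> p \<in> Arr C \<and>
     (\<exists>q \<in> hom C (tgt C p) (src C p).
        ide C (src C p) \<sqsubseteq>\<^bsub>C\<^esub> q \<cdot>\<^bsub>C\<^esub> p \<and> p \<cdot>\<^bsub>C\<^esub> q \<sqsubseteq>\<^bsub>C\<^esub> ide C (tgt C p))"

text \<open>The span \<open>(p, q)\<close> is a pullback of the cospan \<open>(f, s)\<close>, with \<open>f \<cdot> p = s \<cdot> q\<close>; thus \<open>p\<close> is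
  the pullback of \<open>s\<close> along \<open>f\<close>, and \<open>q\<close> the pullback of \<open>f\<close> along \<open>s\<close>.\<close>

definition is_pullback :: "('o, 'm) ocat \<Rightarrow> 'm \<Rightarrow> 'm \<Rightarrow> 'm \<Rightarrow> 'm \<Rightarrow> bool" where
  "is_pullback C f s p q \<longleftrightarrow>
     f \<in> Arr C \<and> s \<in> Arr C \<and> tgt C f = tgt C s \<and>
     p \<in> hom C (src C p) (src C f) \<and> q \<in> hom C (src C p) (src C s) \<and>
     f \<cdot>\<^bsub>C\<^esub> p = s \<cdot>\<^bsub>C\<^esub> q \<and>
     (\<forall>X. \<forall>a \<in> hom C X (src C f). \<forall>b \<in> hom C X (src C s).
        f \<cdot>\<^bsub>C\<^esub> a = s \<cdot>\<^bsub>C\<^esub> b \<longrightarrow>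
        (\<exists>!h. h \<in> hom C X (src C p) \<and> p \<cdot>\<^bsub>C\<^esub> h = a \<and> q \<cdot>\<^bsub>C\<^esub> h = b))"

section \<open>Lax factorisation systems\<close>

definition lax_square :: "('o, 'm) ocat \<Rightarrow> 'm \<Rightarrow> 'm \<Rightarrow> 'm \<Rightarrow> 'm \<Rightarrow> bool" where
  "lax_square C u v f g \<longleftrightarrow> f \<in> Arr C \<and> g \<in> Arr C \<and>
     u \<in> hom C (src C f) (src C g) \<and> v \<in> hom C (tgt C f) (tgt C g) \<and>
     g \<cdot>\<^bsub>C\<^esub> u \<sqsubseteq>\<^bsub>C\<^esub> v \<cdot>\<^bsub>C\<^esub> f"

definition lax_orthogonal :: "('o, 'm) ocat \<Rightarrow> 'm \<Rightarrow> 'm \<Rightarrow> bool" where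
  "lax_orthogonal C f g \<longleftrightarrow>
     (\<forall>u v. lax_square C u v f g \<longrightarrow>
        (\<exists>d \<in> hom C (tgt C f) (src C g).
           u \<sqsubseteq>\<^bsub>C\<^esub> d \<cdot>\<^bsub>C\<^esub> f \<and> g \<cdot>\<^bsub>C\<^esub> d \<sqsubseteq>\<^bsub>C\<^esub> v))"

locale lax_weak_factorisation_system = ord_category C
  for C :: "('o, 'm) ocat" (structure) +
  fixes LL RR :: "'m set"
  assumes RR_eq: "RR = {g \<in> Arr C. \<forall>f \<in> LL. lax_orthogonal C f g}"
    and LL_eq: "LL = {f \<in> Arr C. \<forall>g \<in> RR. lax_orthogonal C f g}"
    and factorise: "f \<in> Arr C \<Longrightarrow> \<exists>l \<in> LL. \<exists>r \<in> RR. tgt C l = src C r \<and> f = r \<cdot> l"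

text \<open>\<open>Ko\<close> is the object part of \<open>K\<close>; its value \<open>K(u, v)\<close> on a lax square
  \<open>(u, v) : f \<rightarrow> g\<close> is written \<open>Km f g u v\<close>, since \<open>f\<close> and \<open>g\<close> are not determined by
  \<open>u\<close> and \<open>v\<close>.\<close>

locale lax_functorial_factorisation_system = ord_category C
  for C :: "('o, 'm) ocat" (structure) +
  fixes Ko :: "'m \<Rightarrow> 'o"
    and L R :: "'m \<Rightarrow> 'm"
    and Km :: "'m \<Rightarrow> 'm \<Rightarrow> 'm \<Rightarrow> 'm \<Rightarrow> 'm"
  assumes L_hom: "f \<in> Arr C \<Longrightarrow> L f \<in> hom C (src C f) (Ko f)"
    and R_hom: "f \<in> Arr C \<Longrightarrow> R f \<in> hom C (Ko f) (tgt C f)"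
    and factorisation: "f \<in> Arr C \<Longrightarrow> R f \<cdot> L f = f"
    and Km_hom: "lax_square C u v f g \<Longrightarrow> Km f g u v \<in> hom C (Ko f) (Ko g)"
    and L_lax: "lax_square C u v f g \<Longrightarrow> L g \<cdot> u \<sqsubseteq> Km f g u v \<cdot> L f"
    and R_lax: "lax_square C u v f g \<Longrightarrow> R g \<cdot> Km f g u v \<sqsubseteq> v \<cdot> R f"
    and Km_ide: "f \<in> Arr C \<Longrightarrow> Km f f (ide C (src C f)) (ide C (tgt C f)) = ide C (Ko f)"
    and Km_compose: "\<lbrakk>lax_square C u v f g; lax_square C u' v' g h\<rbrakk>
        \<Longrightarrow> Km f h (u' \<cdot> u) (v' \<cdot> v) = Km g h u' v' \<cdot> Km f g u v"

definition predistributive :: "('o, 'm) ocat \<Rightarrow> ('m \<Rightarrow> 'm) \<Rightarrow> ('m \<Rightarrow> 'm) \<Rightarrow> bool" where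
  "predistributive C L R \<longleftrightarrow>
     (\<forall>f \<in> Arr C. lax_orthogonal C (L f) (R (L f)) \<and> lax_orthogonal C (L (R f)) (R f))"

definition underlies ::
  "('o, 'm) ocat \<Rightarrow> 'm set \<Rightarrow> 'm set \<Rightarrow> ('m \<Rightarrow> 'm) \<Rightarrow> ('m \<Rightarrow> 'm) \<Rightarrow> bool" where
  "underlies C LL RR L R \<longleftrightarrow> (\<forall>f \<in> Arr C. L f \<in> LL \<and> R f \<in> RR)"

section \<open>Partial maps\<close>

text \<open>Ordinary pullbacks suffice: since the members of \<open>S\<close> are full and stable under pullback,
  pullbacks along them are automatically compatible with the order.\<close>

locale class_of_subobjects = ord_category C
  for C :: "('o, 'm) ocat" (structure) +
  fixes S :: "'m set"
  assumes S_monic: "s \<in> S \<Longrightarrow> monic C s"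
    and S_compose: "\<lbrakk>s \<in> S; t \<in> S; tgt C s = src C t\<rbrakk> \<Longrightarrow> t \<cdot> s \<in> S"
    and S_split: "split_monic C s \<Longrightarrow> s \<in> S"
    and S_has_pullbacks: "\<lbrakk>s \<in> S; f \<in> Arr C; tgt C f = tgt C s\<rbrakk> \<Longrightarrow> \<exists>p q. is_pullback C f s p q"
    and S_stable: "\<lbrakk>s \<in> S; is_pullback C f s p q\<rbrakk> \<Longrightarrow> p \<in> S"
    and S_full: "\<lbrakk>s \<in> S; a \<in> hom C X (src C s); b \<in> hom C X (src C s); s \<cdot> a \<sqsubseteq> s \<cdot> b\<rbrakk> \<Longrightarrow> a \<sqsubseteq> b"

definition spans :: "('o, 'm) ocat \<Rightarrow> 'm set \<Rightarrow> ('m \<times> 'm) set" where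
  "spans C S = {(\<sigma>, \<phi>). \<sigma> \<in> S \<and> \<phi> \<in> Arr C \<and> src C \<sigma> = src C \<phi>}"

definition span_iso :: "('o, 'm) ocat \<Rightarrow> 'm set \<Rightarrow> (('m \<times> 'm) \<times> ('m \<times> 'm)) set" where
  "span_iso C S = {((\<sigma>, \<phi>), (\<sigma>', \<phi>')). (\<sigma>, \<phi>) \<in> spans C S \<and> (\<sigma>', \<phi>') \<in> spans C S \<and>
     (\<exists>i \<in> hom C (src C \<sigma>') (src C \<sigma>). iso C i \<and> \<sigma>' = \<sigma> \<cdot>\<^bsub>C\<^esub> i \<and> \<phi>' = \<phi> \<cdot>\<^bsub>C\<^esub> i)}"

text \<open>A partial map is an isomorphism class of spans \<open>(\<sigma>, \<phi>)\<close>.\<close>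

definition pmap :: "('o, 'm) ocat \<Rightarrow> 'm set \<Rightarrow> 'm \<Rightarrow> 'm \<Rightarrow> ('m \<times> 'm) set" where
  "pmap C S \<sigma> \<phi> = span_iso C S `` {(\<sigma>, \<phi>)}"

text \<open>Letting the representatives and the pullback vary yields a full isomorphism class, so no
  choice of pullbacks is needed.\<close>

definition pcompose ::
  "('o, 'm) ocat \<Rightarrow> ('m \<times> 'm) set \<Rightarrow> ('m \<times> 'm) set \<Rightarrow> ('m \<times> 'm) set" where
  "pcompose C g f = {(\<sigma>f \<cdot>\<^bsub>C\<^esub> p, \<phi>g \<cdot>\<^bsub>C\<^esub> q) | \<sigma>f \<phi>f \<sigma>g \<phi>g p q.
     (\<sigma>f, \<phi>f) \<in> f \<and> (\<sigma>g, \<phi>g) \<in> g \<and> is_pullback C \<phi>f \<sigma>g p q}"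

definition pleq :: "('o, 'm) ocat \<Rightarrow> 'm set \<Rightarrow> ('m \<times> 'm) set \<Rightarrow> ('m \<times> 'm) set \<Rightarrow> bool" where
  "pleq C S f g \<longleftrightarrow> f \<in> spans C S // span_iso C S \<and> g \<in> spans C S // span_iso C S \<and>
     (\<exists>\<sigma>f \<phi>f \<sigma>g \<phi>g s. (\<sigma>f, \<phi>f) \<in> f \<and> (\<sigma>g, \<phi>g) \<in> g \<and>
        s \<in> S \<and> s \<in> hom C (src C \<sigma>f) (src C \<sigma>g) \<and>
        \<sigma>f = \<sigma>g \<cdot>\<^bsub>C\<^esub> s \<and> \<phi>f \<sqsubseteq>\<^bsub>C\<^esub> \<phi>g \<cdot>\<^bsub>C\<^esub> s)"

definition PMap :: "('o, 'm) ocat \<Rightarrow> 'm set \<Rightarrow> ('o, ('m \<times> 'm) set) ocat" where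
  "PMap C S =
     \<lparr>Obj = Obj C,
      Arr = spans C S // span_iso C S,
      src = (\<lambda>f. the_elem ((\<lambda>(\<sigma>, \<phi>). tgt C \<sigma>) ` f)),
      tgt = (\<lambda>f. the_elem ((\<lambda>(\<sigma>, \<phi>). tgt C \<phi>) ` f)),
      ide = (\<lambda>A. pmap C S (ide C A) (ide C A)),
      compose = pcompose C,
      leq = pleq C S\<rparr>"

definition Tot :: "('o, 'm) ocat \<Rightarrow> 'm set \<Rightarrow> ('m \<times> 'm) set set" where
  "Tot C S = {f \<in> Arr (PMap C S). \<exists>(\<sigma>, \<phi>) \<in> f. iso C \<sigma>}"

definition PLA :: "('o, 'm) ocat \<Rightarrow> 'm set \<Rightarrow> ('m \<times> 'm) set set" where
  "PLA C S = {f \<in> Arr (PMap C S). \<exists>(\<sigma>f, \<phi>f) \<in> f. \<exists>\<sigma> \<in> S. \<exists>\<psi> \<in> hom C (src C \<phi>f) (src C \<sigma>).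
     left_adjoint C \<psi> \<and> \<phi>f = \<sigma> \<cdot>\<^bsub>C\<^esub> \<psi>}"

section \<open>The factorisation of partial maps\<close>

text \<open>The partial domain \<open>D\<^sub>f\<close> is determined only up to isomorphism. Here \<open>rep\<close> picks a
  representing span \<open>(\<sigma>\<^sub>f, \<phi>\<^sub>f)\<close> for every partial map \<open>f\<close>.\<close>

definition pK :: "('o, 'm) ocat \<Rightarrow> (('m \<times> 'm) set \<Rightarrow> 'm \<times> 'm) \<Rightarrow> ('m \<times> 'm) set \<Rightarrow> 'o" where
  "pK C rep f = src C (fst (rep f))"

definition pL ::
  "('o, 'm) ocat \<Rightarrow> 'm set \<Rightarrow> (('m \<times> 'm) set \<Rightarrow> 'm \<times> 'm) \<Rightarrow> ('m \<times> 'm) set \<Rightarrow> ('m \<times> 'm) set" where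
  "pL C S rep f = pmap C S (fst (rep f)) (ide C (pK C rep f))"

definition pR ::
  "('o, 'm) ocat \<Rightarrow> 'm set \<Rightarrow> (('m \<times> 'm) set \<Rightarrow> 'm \<times> 'm) \<Rightarrow> ('m \<times> 'm) set \<Rightarrow> ('m \<times> 'm) set" where
  "pR C S rep f = pmap C S (ide C (pK C rep f)) (snd (rep f))"

text \<open>In the following, \<open>(\<sigma>u \<cdot> p, \<phi>g \<cdot> q)\<close> represents \<open>g \<cdot> u\<close>, \<open>(\<sigma>f \<cdot> p', \<phi>v \<cdot> q')\<close> represents
  \<open>v \<cdot> f\<close>, and \<open>s\<close> witnesses \<open>g \<cdot> u \<le> v \<cdot> f\<close>. The component \<open>p' \<cdot> s\<close> depends on \<open>p\<close> alone, as
  \<open>\<sigma>f\<close> is monic; as for \<open>pcompose\<close>, the set is a full isomorphism class.\<close>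

definition pKm ::
  "('o, 'm) ocat \<Rightarrow> 'm set \<Rightarrow> (('m \<times> 'm) set \<Rightarrow> 'm \<times> 'm) \<Rightarrow>
   ('m \<times> 'm) set \<Rightarrow> ('m \<times> 'm) set \<Rightarrow> ('m \<times> 'm) set \<Rightarrow> ('m \<times> 'm) set \<Rightarrow> ('m \<times> 'm) set" where
  "pKm C S rep f g u v =
     (let (\<sigma>f, \<phi>f) = rep f; (\<sigma>g, \<phi>g) = rep g in
      {(p' \<cdot>\<^bsub>C\<^esub> s, q) | p' s q p q' \<sigma>u \<phi>u \<sigma>v \<phi>v.
         (\<sigma>u, \<phi>u) \<in> u \<and> (\<sigma>v, \<phi>v) \<in> v \<and>
         is_pullback C \<phi>u \<sigma>g p q \<and> is_pullback C \<phi>f \<sigma>v p' q' \<and>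
         s \<in> S \<and> s \<in> hom C (src C p) (src C p') \<and>
         \<sigma>u \<cdot>\<^bsub>C\<^esub> p = (\<sigma>f \<cdot>\<^bsub>C\<^esub> p') \<cdot>\<^bsub>C\<^esub> s \<and>
         \<phi>g \<cdot>\<^bsub>C\<^esub> q \<sqsubseteq>\<^bsub>C\<^esub> (\<phi>v \<cdot>\<^bsub>C\<^esub> q') \<cdot>\<^bsub>C\<^esub> s})"

end

(* A partial map (s, a) factors as a_* after s^*, where a_* = (id, a) is total and s^* = (s, id).
   For s in S there is an adjunction of s_* (left) and s^* (right) with s^* . s_* = id. Hence
   s^* = L f is split epi and K(u, v) is determined by K(u, v) . L f = L g . u, which gives functoriality.

   If f = s_* . p_* . t^* with p left adjoint to q, and (u, v) : f -> g is a lax square with g total,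
   then the domain of u is contained in that of f, so u factors through t^* and
   u . t_* . t^* = u; this makes d = u . t_* . q_* . s^* a diagonal.
   Conversely, lifting L g against g gives a one-sided inverse of s_g, and lifting f against R f gives a
   partial map (e, r) whose components factor phi_f as e . p with p left adjoint to r. *)
theory Submission
  imports Defs
begin

section \<open>Ord-enriched categories\<close>

text \<open>The diagonal comes from replacing each of the three factors of \<open>f\<close> by its
  adjoint partner, in reversed order. For \<open>lower \<psi>\<close> and
  \<open>lower \<sigma>\<close>, which are left adjoints, units and counits point in the required
  directions. The factor \<open>upper \<tau>\<close>, however, is a right adjoint: the composite of
  \<open>lower \<tau>\<close> after \<open>upper \<tau>\<close> lies only below the identity, while
  \<open>u \<preceq> d \<bullet> f\<close> needs a bound from the other side. Totality of
  \<open>g\<close> removes this obstacle: postcomposing with a total map does not change a domain,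
  so the domain part of the lax square is a statement about \<open>u\<close> itself. For the
  converses, the two test squares commute strictly, both composites being the given map in its
  factored form. An inequality of partial maps contains an equation between domain inclusions, and
  this equation is what yields sections in \<open>C\<close>. Fullness of the members of
  \<open>S\<close> turns an inequality after an inclusion into the counit of an adjunction. Since no
  pullbacks are chosen, composition and order are computed on arbitrary representatives;
  monotonicity of composition in \<open>PMap C S\<close> then allows inequalities to be whiskered
  freely.\<close>

context ord_category
begin

declare leq_trans [trans]

lemma compose_Arr [simp]:
  assumes "f \<in> Arr C" "g \<in> Arr C" "tgt C f = src C g"
  shows "g \<cdot> f \<in> Arr C" "src C (g \<cdot> f) = src C f" "tgt C (g \<cdot> f) = tgt C g"
  using compose_hom[of f "src C f" "tgt C f" g "tgt C g"] assms by (auto simp: hom_def)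

lemma ide_Arr [simp]:
  assumes "A \<in> Obj C"
  shows "ide C A \<in> Arr C" "src C (ide C A) = A" "tgt C (ide C A) = A"
  using ide_hom[OF assms] by (auto simp: hom_def)

lemma ide_simps [simp]:
  assumes "f \<in> Arr C"
  shows "A = src C f \<Longrightarrow> f \<cdot> ide C A = f" "A = tgt C f \<Longrightarrow> ide C A \<cdot> f = f"
  using assms ide_right[of f "src C f" "tgt C f"] ide_left[of f "src C f" "tgt C f"]
  by (auto simp: hom_def)

lemma src_tgt_Obj [simp]:
  assumes "f \<in> Arr C"
  shows "src C f \<in> Obj C" "tgt C f \<in> Obj C"
  using assms src_Obj tgt_Obj by auto

lemma assoc_Arr [simp]:
  assumes "f \<in> Arr C" "g \<in> Arr C" "h \<in> Arr C" "tgt C f = src C g" "tgt C g = src C h"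
  shows "(h \<cdot> g) \<cdot> f = h \<cdot> (g \<cdot> f)"
  using assoc[of f "src C f" "src C g" g "src C h" h "tgt C h"] assms by (auto simp: hom_def)

text \<open>Composites are normalised to the right by \<open>assoc_Arr\<close>, so after
  precomposition the left side of a commuting square no longer occurs as a subterm. This form of the
  square survives the normalisation.\<close>

lemma compose_eq_extend:
  assumes "f \<cdot> p = s \<cdot> q" "p \<in> Arr C" "q \<in> Arr C" "f \<in> Arr C" "s \<in> Arr C" "x \<in> Arr C"
    "tgt C p = src C f" "tgt C q = src C s" "tgt C x = src C p" "tgt C x = src C q"
  shows "f \<cdot> (p \<cdot> x) = s \<cdot> (q \<cdot> x)"
  using assms assoc_Arr[of x p f] assoc_Arr[of x q s] by simp

lemma leqD:
  assumes "f \<sqsubseteq> g"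
  shows "f \<in> Arr C" "g \<in> Arr C" "src C f = src C g" "tgt C f = tgt C g"
  using leq_parallel[OF assms] by (auto simp: hom_def)

lemma leq_compose:
  assumes "f \<sqsubseteq> f'" "g \<sqsubseteq> g'" "tgt C f = src C g"
  shows "g \<cdot> f \<sqsubseteq> g' \<cdot> f'"
  using compose_mono assms unfolding monotone_composition_def by blast

lemma leq_compose_left:
  assumes "f \<sqsubseteq> f'" "g \<in> Arr C" "tgt C f = src C g"
  shows "g \<cdot> f \<sqsubseteq> g \<cdot> f'"
  using leq_compose assms leq_refl by blast

lemma leq_compose_right:
  assumes "g \<sqsubseteq> g'" "f \<in> Arr C" "tgt C f = src C g"
  shows "g \<cdot> f \<sqsubseteq> g' \<cdot> f"
  using leq_compose assms leq_refl by blast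

lemma iso_Arr [simp]: "iso C i \<Longrightarrow> i \<in> Arr C"
  by (simp add: iso_def)

lemma iso_inverse:
  assumes "iso C i"
  obtains j where "iso C j" "src C j = tgt C i" "tgt C j = src C i"
    "j \<cdot> i = ide C (src C i)" "i \<cdot> j = ide C (tgt C i)"
  using assms unfolding iso_def hom_def by force

lemma isoI:
  assumes "i \<in> Arr C" "j \<in> Arr C" "src C j = tgt C i" "tgt C j = src C i"
    "j \<cdot> i = ide C (src C i)" "i \<cdot> j = ide C (tgt C i)"
  shows "iso C i"
  using assms unfolding iso_def hom_def by force

lemma iso_ide [simp]: "A \<in> Obj C \<Longrightarrow> iso C (ide C A)"
  by (rule isoI[of _ "ide C A"]) auto

lemma iso_compose:
  assumes "iso C i" "iso C k" "tgt C i = src C k"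
  shows "iso C (k \<cdot> i)"
proof -
  obtain j where j: "iso C j" "src C j = tgt C i" "tgt C j = src C i"
    "j \<cdot> i = ide C (src C i)" "i \<cdot> j = ide C (tgt C i)" using iso_inverse[OF assms(1)] .
  obtain l where l: "iso C l" "src C l = tgt C k" "tgt C l = src C k"
    "l \<cdot> k = ide C (src C k)" "k \<cdot> l = ide C (tgt C k)" using iso_inverse[OF assms(2)] .
  have 1: "l \<cdot> (k \<cdot> i) = i"
    using assoc_Arr[of i k l] assms l by simp
  have 2: "i \<cdot> (j \<cdot> l) = l"
    using assoc_Arr[of l j i] assms j l by simp
  show ?thesis
    by (rule isoI[of _ "j \<cdot> l"]) (simp_all add: assms j l 1 2)
qed

lemma monicD:
  assumes "monic C m" "m \<cdot> a = m \<cdot> b" "a \<in> Arr C" "b \<in> Arr C" "src C a = src C b"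
    "tgt C a = src C m" "tgt C b = src C m"
  shows "a = b"
  using assms unfolding monic_def hom_def by blast

section \<open>Pullbacks: universal property, pasting, degenerate cases, change of apex\<close>

lemma pullbackD:
  assumes "is_pullback C f s p q"
  shows "f \<in> Arr C" "s \<in> Arr C" "tgt C f = tgt C s" "p \<in> Arr C" "q \<in> Arr C"
    "src C q = src C p" "tgt C p = src C f" "tgt C q = src C s" "f \<cdot> p = s \<cdot> q"
  using assms unfolding is_pullback_def hom_def by auto

lemma pullback_universal:
  assumes "is_pullback C f s p q" "a \<in> Arr C" "b \<in> Arr C" "src C a = src C b"
    "tgt C a = src C f" "tgt C b = src C s" "f \<cdot> a = s \<cdot> b"
  obtains h where "h \<in> Arr C" "src C h = src C a" "tgt C h = src C p" "p \<cdot> h = a" "q \<cdot> h = b"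
proof -
  have "a \<in> hom C (src C a) (src C f)" "b \<in> hom C (src C a) (src C s)"
    using assms by (auto simp: hom_def)
  then obtain h where "h \<in> hom C (src C a) (src C p)" "p \<cdot> h = a" "q \<cdot> h = b"
    using assms(1,7) unfolding is_pullback_def by blast
  then show ?thesis using that by (auto simp: hom_def)
qed

lemma pullback_jointly_monic:
  assumes "is_pullback C f s p q" "h \<in> Arr C" "k \<in> Arr C" "src C h = src C k"
    "tgt C h = src C p" "tgt C k = src C p" "p \<cdot> h = p \<cdot> k" "q \<cdot> h = q \<cdot> k"
  shows "h = k"
proof -
  note D = pullbackD[OF assms(1)]
  have "p \<cdot> h \<in> hom C (src C h) (src C f)" "q \<cdot> h \<in> hom C (src C h) (src C s)"
    using assms D by (auto simp: hom_def)
  moreover have "f \<cdot> (p \<cdot> h) = s \<cdot> (q \<cdot> h)"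
    by (rule compose_eq_extend) (simp_all add: assms D)
  ultimately have "\<exists>!x. x \<in> hom C (src C h) (src C p) \<and> p \<cdot> x = p \<cdot> h \<and> q \<cdot> x = q \<cdot> h"
    using assms(1) unfolding is_pullback_def by blast
  moreover have "h \<in> hom C (src C h) (src C p)" "k \<in> hom C (src C h) (src C p)"
    using assms by (auto simp: hom_def)
  ultimately show ?thesis using assms(7,8) by metis
qed

text \<open>Splits the unique existence in the universal property into existence and joint monicity
  of the two legs, which are usually proved by separate arguments.\<close>

lemma pullbackI:
  assumes "f \<in> Arr C" "s \<in> Arr C" "tgt C f = tgt C s" "p \<in> Arr C" "q \<in> Arr C"
    "src C q = src C p" "tgt C p = src C f" "tgt C q = src C s" "f \<cdot> p = s \<cdot> q"
    and ex: "\<And>a b. \<lbrakk>a \<in> Arr C; b \<in> Arr C; src C a = src C b; tgt C a = src C f; tgt C b = src C s;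
      f \<cdot> a = s \<cdot> b\<rbrakk> \<Longrightarrow> \<exists>h. h \<in> Arr C \<and> src C h = src C a \<and> tgt C h = src C p \<and> p \<cdot> h = a \<and> q \<cdot> h = b"
    and uniq: "\<And>h k. \<lbrakk>h \<in> Arr C; k \<in> Arr C; src C h = src C k; tgt C h = src C p; tgt C k = src C p;
      p \<cdot> h = p \<cdot> k; q \<cdot> h = q \<cdot> k\<rbrakk> \<Longrightarrow> h = k"
  shows "is_pullback C f s p q"
  unfolding is_pullback_def
proof (intro conjI allI ballI impI)
  fix X a b assume *: "a \<in> hom C X (src C f)" "b \<in> hom C X (src C s)" "f \<cdot> a = s \<cdot> b"
  then obtain h where h: "h \<in> Arr C" "src C h = X" "tgt C h = src C p" "p \<cdot> h = a" "q \<cdot> h = b"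
    using ex[of a b] by (auto simp: hom_def)
  show "\<exists>!h. h \<in> hom C X (src C p) \<and> p \<cdot> h = a \<and> q \<cdot> h = b"
  proof (rule ex1I[of _ h])
    show "h \<in> hom C X (src C p) \<and> p \<cdot> h = a \<and> q \<cdot> h = b" using h by (simp add: hom_def)
    fix k assume "k \<in> hom C X (src C p) \<and> p \<cdot> k = a \<and> q \<cdot> k = b"
    then show "k = h" using uniq[of k h] h by (simp add: hom_def)
  qed
qed (use assms(1-9) in \<open>auto simp: hom_def\<close>)

lemma pullback_sym:
  assumes "is_pullback C f s p q"
  shows "is_pullback C s f q p"
proof -
  note D = pullbackD[OF assms]
  show ?thesis
  proof (rule pullbackI)
    fix a b assume "a \<in> Arr C" "b \<in> Arr C" "src C a = src C b" "tgt C a = src C s"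
      "tgt C b = src C f" "s \<cdot> a = f \<cdot> b"
    then show "\<exists>h. h \<in> Arr C \<and> src C h = src C a \<and> tgt C h = src C q \<and> q \<cdot> h = a \<and> p \<cdot> h = b"
      using pullback_universal[OF assms, of b a] D by metis
  next
    fix h k assume "h \<in> Arr C" "k \<in> Arr C" "src C h = src C k" "tgt C h = src C q"
      "tgt C k = src C q" "q \<cdot> h = q \<cdot> k" "p \<cdot> h = p \<cdot> k"
    then show "h = k" using pullback_jointly_monic[OF assms, of h k] D by metis
  qed (simp_all add: D)
qed

text \<open>A cone over the outer rectangle is lifted through \<open>P\<close> and the result
  through \<open>Q\<close>; uniqueness goes back through the same two squares. Together with its
  transpose \<open>pullback_pasting'\<close> it yields associativity of composition of partial
  maps.\<close>

lemma pullback_pasting: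
  assumes P: "is_pullback C f s p q" and Q: "is_pullback C q t a b"
  shows "is_pullback C f (s \<cdot> t) (p \<cdot> a) b"
proof -
  note D = pullbackD[OF P] and E = pullbackD[OF Q]
  have eq: "f \<cdot> (p \<cdot> a) = s \<cdot> (q \<cdot> a)"
    by (rule compose_eq_extend) (simp_all add: D E)
  show ?thesis
  proof (rule pullbackI)
    fix x y assume x: "x \<in> Arr C" "y \<in> Arr C" "src C x = src C y" "tgt C x = src C f"
      "tgt C y = src C (s \<cdot> t)" "f \<cdot> x = (s \<cdot> t) \<cdot> y"
    have y: "tgt C y = src C t" "tgt C t = src C s" "f \<cdot> x = s \<cdot> (t \<cdot> y)" using x(2,5,6) D E by simp_all
    obtain h where h: "h \<in> Arr C" "src C h = src C x" "tgt C h = src C p" "p \<cdot> h = x" "q \<cdot> h = t \<cdot> y"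
      by (rule pullback_universal[OF P, of x "t \<cdot> y"]) (simp_all add: x(1-4) y D E)
    obtain k where "k \<in> Arr C" "src C k = src C h" "tgt C k = src C a" "a \<cdot> k = h" "b \<cdot> k = y"
      by (rule pullback_universal[OF Q, of h y]) (simp_all add: h x(1-4) y D E)
    then show "\<exists>k. k \<in> Arr C \<and> src C k = src C x \<and> tgt C k = src C (p \<cdot> a) \<and> (p \<cdot> a) \<cdot> k = x \<and> b \<cdot> k = y"
      using h D E by (intro exI[of _ k]) auto
  next
    fix h k assume *: "h \<in> Arr C" "k \<in> Arr C" "src C h = src C k" "tgt C h = src C (p \<cdot> a)"
      "tgt C k = src C (p \<cdot> a)" "(p \<cdot> a) \<cdot> h = (p \<cdot> a) \<cdot> k" "b \<cdot> h = b \<cdot> k"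
    have hk: "tgt C h = src C a" "tgt C k = src C a" "p \<cdot> (a \<cdot> h) = p \<cdot> (a \<cdot> k)"
      using *(1,2,4-6) D E by simp_all
    have 1: "q \<cdot> (a \<cdot> h) = t \<cdot> (b \<cdot> h)"
      by (rule compose_eq_extend[OF E(9)]) (simp_all add: D E *(1-3) hk)
    have 2: "q \<cdot> (a \<cdot> k) = t \<cdot> (b \<cdot> k)"
      by (rule compose_eq_extend[OF E(9)]) (simp_all add: D E *(1-3) hk)
    have 3: "a \<cdot> h = a \<cdot> k"
      by (rule pullback_jointly_monic[OF P]) (simp_all add: D E *(1-3,7) hk 1 2)
    show "h = k"
      by (rule pullback_jointly_monic[OF Q]) (simp_all add: D E *(1-3,7) hk 3)
  qed (use D E eq in simp_all)
qed

lemma pullback_pasting':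
  assumes "is_pullback C g s p q" "is_pullback C f p a b"
  shows "is_pullback C (g \<cdot> f) s a (q \<cdot> b)"
  using pullback_sym[OF pullback_pasting[OF pullback_sym pullback_sym]] assms by blast

lemma pullback_ide_right:
  assumes "f \<in> Arr C" "A = tgt C f"
  shows "is_pullback C f (ide C A) (ide C (src C f)) f"
proof (rule pullbackI)
  fix a b assume "a \<in> Arr C" "b \<in> Arr C" "tgt C a = src C f" "tgt C b = src C (ide C A)"
    "f \<cdot> a = ide C A \<cdot> b"
  then show "\<exists>h. h \<in> Arr C \<and> src C h = src C a \<and> tgt C h = src C (ide C (src C f)) \<and>
      ide C (src C f) \<cdot> h = a \<and> f \<cdot> h = b"
    using assms by (intro exI[of _ a]) auto
qed (simp_all add: assms)

lemma pullback_ide_left: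
  assumes "s \<in> Arr C" "A = tgt C s"
  shows "is_pullback C (ide C A) s s (ide C (src C s))"
  using pullback_sym[OF pullback_ide_right] assms by blast

lemma pullback_monic_self:
  assumes "monic C s"
  shows "is_pullback C s s (ide C (src C s)) (ide C (src C s))"
proof (rule pullbackI)
  show "s \<in> Arr C" "s \<in> Arr C" using assms by (auto simp: monic_def)
  fix a b assume "a \<in> Arr C" "b \<in> Arr C" "src C a = src C b" "tgt C a = src C s" "tgt C b = src C s"
    "s \<cdot> a = s \<cdot> b"
  then show "\<exists>h. h \<in> Arr C \<and> src C h = src C a \<and> tgt C h = src C (ide C (src C s)) \<and>
      ide C (src C s) \<cdot> h = a \<and> ide C (src C s) \<cdot> h = b"
    using assms monicD[of s a b] by (intro exI[of _ a]) (auto simp: monic_def)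
qed (use assms in \<open>auto simp: monic_def\<close>)

text \<open>Pullbacks may be reparametrised by an isomorphism of the apex. This is why
  \<open>pcompose\<close> and \<open>pKm\<close>, in which the pullback varies, contain a whole
  isomorphism class of spans.\<close>

lemma pullback_compose_iso:
  assumes P: "is_pullback C f s p q" and i: "iso C i" "tgt C i = src C p"
  shows "is_pullback C f s (p \<cdot> i) (q \<cdot> i)"
proof -
  note D = pullbackD[OF P]
  obtain j where j: "iso C j" "src C j = tgt C i" "tgt C j = src C i"
    "j \<cdot> i = ide C (src C i)" "i \<cdot> j = ide C (tgt C i)" using iso_inverse[OF i(1)] .
  have cancel: "i \<cdot> (j \<cdot> h) = h" if "h \<in> Arr C" "tgt C h = src C p" for h
    using assoc_Arr[of h j i] that i j D by simp
  have cancel': "j \<cdot> (i \<cdot> h) = h" if "h \<in> Arr C" "tgt C h = src C i" for h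
    using assoc_Arr[of h i j] that i j D by simp
  show ?thesis
  proof (rule pullbackI)
    show "f \<cdot> (p \<cdot> i) = s \<cdot> (q \<cdot> i)"
      by (rule compose_eq_extend) (simp_all add: D i)
    fix a b assume a: "a \<in> Arr C" "b \<in> Arr C" "src C a = src C b" "tgt C a = src C f" "tgt C b = src C s"
      "f \<cdot> a = s \<cdot> b"
    then obtain h where "h \<in> Arr C" "src C h = src C a" "tgt C h = src C p" "p \<cdot> h = a" "q \<cdot> h = b"
      using pullback_universal[OF P] by metis
    then show "\<exists>h. h \<in> Arr C \<and> src C h = src C a \<and> tgt C h = src C (p \<cdot> i) \<and>
        (p \<cdot> i) \<cdot> h = a \<and> (q \<cdot> i) \<cdot> h = b"
      using i j D by (intro exI[of _ "j \<cdot> h"]) (auto simp: cancel)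
  next
    fix h k assume *: "h \<in> Arr C" "k \<in> Arr C" "src C h = src C k" "tgt C h = src C (p \<cdot> i)"
      "tgt C k = src C (p \<cdot> i)" "(p \<cdot> i) \<cdot> h = (p \<cdot> i) \<cdot> k" "(q \<cdot> i) \<cdot> h = (q \<cdot> i) \<cdot> k"
    have hk: "tgt C h = src C i" "tgt C k = src C i" "p \<cdot> (i \<cdot> h) = p \<cdot> (i \<cdot> k)" "q \<cdot> (i \<cdot> h) = q \<cdot> (i \<cdot> k)"
      using *(1,2,4-7) D i by simp_all
    have "i \<cdot> h = i \<cdot> k"
      by (rule pullback_jointly_monic[OF P]) (simp_all add: *(1-3) D i hk)
    then have "j \<cdot> (i \<cdot> h) = j \<cdot> (i \<cdot> k)" by simp
    then show "h = k" using cancel'[of h] cancel'[of k] * D i by simp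
  qed (simp_all add: D i)
qed

end


section \<open>Partial maps as classes of spans\<close>

context class_of_subobjects
begin

lemma S_Arr [simp]: "s \<in> S \<Longrightarrow> s \<in> Arr C"
  using S_monic by (auto simp: monic_def)

lemma S_monicD:
  assumes "m \<in> S" "m \<cdot> a = m \<cdot> b" "a \<in> Arr C" "b \<in> Arr C" "src C a = src C b"
    "tgt C a = src C m" "tgt C b = src C m"
  shows "a = b"
  using assms monicD S_monic by blast

lemma S_iso [simp]: "iso C i \<Longrightarrow> i \<in> S"
  by (rule S_split) (auto simp: iso_def split_monic_def)

lemma S_ide [simp]: "A \<in> Obj C \<Longrightarrow> ide C A \<in> S"
  by simp

text \<open>Pasting the trivial kernel pair of the monic \<open>t\<close> with an identity square
  exhibits \<open>s\<close> as the pullback of \<open>t \<cdot> s\<close> along \<open>t\<close>, so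
  stability under pullback applies.\<close>

lemma S_cancel:
  assumes "t \<cdot> s \<in> S" "t \<in> S" "s \<in> Arr C" "tgt C s = src C t"
  shows "s \<in> S"
proof (rule S_stable[OF assms(1)])
  show "is_pullback C t (t \<cdot> s) s (ide C (src C s))"
    using pullback_pasting[OF pullback_monic_self[OF S_monic[OF assms(2)]] pullback_ide_left[OF assms(3)]] assms
    by simp
qed

section \<open>Isomorphism of spans and independence of the representative\<close>

lemma spans_iff: "(\<sigma>, \<phi>) \<in> spans C S \<longleftrightarrow> \<sigma> \<in> S \<and> \<phi> \<in> Arr C \<and> src C \<sigma> = src C \<phi>"
  by (simp add: spans_def)

text \<open>Isomorphisms lie in \<open>S\<close>, so reparametrising a span gives a span again; the
  condition on the second span is thus automatic and an equivalence amounts to the choice of one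
  isomorphism.\<close>

lemma span_iso_iff:
  "((\<sigma>, \<phi>), x) \<in> span_iso C S \<longleftrightarrow>
     (\<sigma>, \<phi>) \<in> spans C S \<and> (\<exists>i. iso C i \<and> tgt C i = src C \<sigma> \<and> x = (\<sigma> \<cdot> i, \<phi> \<cdot> i))"
    (is "?L \<longleftrightarrow> ?R")
proof
  assume ?L
  then show ?R by (auto simp: span_iso_def hom_def)
next
  assume ?R
  then obtain i where i: "(\<sigma>, \<phi>) \<in> spans C S" "iso C i" "tgt C i = src C \<sigma>" "x = (\<sigma> \<cdot> i, \<phi> \<cdot> i)"
    by blast
  moreover have "(\<sigma> \<cdot> i, \<phi> \<cdot> i) \<in> spans C S"
    using i(1-3) by (simp add: spans_iff S_compose)
  moreover have "i \<in> hom C (src C (\<sigma> \<cdot> i)) (src C \<sigma>)"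
    using i(1-3) by (simp add: spans_iff hom_def)
  ultimately show ?L unfolding span_iso_def by blast
qed

lemma equiv_span_iso: "equiv (spans C S) (span_iso C S)"
proof (rule equivI)
  show "span_iso C S \<subseteq> spans C S \<times> spans C S"
    by (auto simp: span_iso_def)
  show "refl_on (spans C S) (span_iso C S)"
  proof (rule refl_onI)
    fix x assume "x \<in> spans C S"
    then obtain \<sigma> \<phi> where x: "x = (\<sigma>, \<phi>)" "(\<sigma>, \<phi>) \<in> spans C S" by (cases x) auto
    then show "(x, x) \<in> span_iso C S"
      using span_iso_iff[of \<sigma> \<phi> x]
      by (auto simp: spans_iff intro!: exI[of _ "ide C (src C \<sigma>)"])
  qed
  show "sym (span_iso C S)"
  proof (rule symI)
    fix x y assume a: "(x, y) \<in> span_iso C S"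
    obtain \<sigma> \<phi> where x: "x = (\<sigma>, \<phi>)" by (cases x)
    then obtain i where i: "(\<sigma>, \<phi>) \<in> spans C S" "iso C i" "tgt C i = src C \<sigma>" "y = (\<sigma> \<cdot> i, \<phi> \<cdot> i)"
      using a by (auto simp: span_iso_iff)
    obtain j where j: "iso C j" "src C j = tgt C i" "tgt C j = src C i"
      "j \<cdot> i = ide C (src C i)" "i \<cdot> j = ide C (tgt C i)" using iso_inverse[OF i(2)] .
    have "(\<sigma> \<cdot> i, \<phi> \<cdot> i) \<in> spans C S" "x = ((\<sigma> \<cdot> i) \<cdot> j, (\<phi> \<cdot> i) \<cdot> j)" "tgt C j = src C (\<sigma> \<cdot> i)"
      using i(1-3) j by (simp_all add: spans_iff S_compose x)
    then show "(y, x) \<in> span_iso C S"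
      using j(1) i(4) span_iso_iff by blast
  qed
  show "trans (span_iso C S)"
  proof (rule transI)
    fix x y z assume a: "(x, y) \<in> span_iso C S" "(y, z) \<in> span_iso C S"
    obtain \<sigma> \<phi> where x: "x = (\<sigma>, \<phi>)" by (cases x)
    then obtain i where i: "(\<sigma>, \<phi>) \<in> spans C S" "iso C i" "tgt C i = src C \<sigma>" "y = (\<sigma> \<cdot> i, \<phi> \<cdot> i)"
      using a by (auto simp: span_iso_iff)
    then obtain j where j: "iso C j" "tgt C j = src C (\<sigma> \<cdot> i)" "z = ((\<sigma> \<cdot> i) \<cdot> j, (\<phi> \<cdot> i) \<cdot> j)"
      using a by (auto simp: span_iso_iff)
    have "tgt C j = src C i" "z = (\<sigma> \<cdot> (i \<cdot> j), \<phi> \<cdot> (i \<cdot> j))"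
      using i(1-3) j by (simp_all add: spans_iff)
    then show "(x, z) \<in> span_iso C S"
      using i(1-3) j(1) x iso_compose[of j i] span_iso_iff[of \<sigma> \<phi> z] by auto
  qed
qed

lemma mem_pmap_iff:
  assumes "(\<sigma>, \<phi>) \<in> spans C S"
  shows "x \<in> pmap C S \<sigma> \<phi> \<longleftrightarrow> (\<exists>i. iso C i \<and> tgt C i = src C \<sigma> \<and> x = (\<sigma> \<cdot> i, \<phi> \<cdot> i))"
  using assms by (auto simp: pmap_def span_iso_iff)

lemma pmap_self:
  assumes "(\<sigma>, \<phi>) \<in> spans C S"
  shows "(\<sigma>, \<phi>) \<in> pmap C S \<sigma> \<phi>"
  using equiv_class_self[OF equiv_span_iso assms] by (simp add: pmap_def)

lemma pmap_Arr:
  assumes "(\<sigma>, \<phi>) \<in> spans C S"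
  shows "pmap C S \<sigma> \<phi> \<in> Arr (PMap C S)"
  using assms by (simp add: PMap_def pmap_def quotientI)

lemma pmap_of_mem:
  assumes "f \<in> Arr (PMap C S)" "(\<sigma>, \<phi>) \<in> f"
  shows "(\<sigma>, \<phi>) \<in> spans C S" "f = pmap C S \<sigma> \<phi>"
proof -
  obtain x where x: "x \<in> spans C S" "f = span_iso C S `` {x}"
    using assms(1) by (auto simp: PMap_def elim: quotientE)
  then have *: "(x, (\<sigma>, \<phi>)) \<in> span_iso C S" using assms(2) by auto
  then show "(\<sigma>, \<phi>) \<in> spans C S" by (auto simp: span_iso_def)
  show "f = pmap C S \<sigma> \<phi>" using equiv_class_eq[OF equiv_span_iso *] x by (simp add: pmap_def)
qed

lemma pmap_cases:
  assumes "f \<in> Arr (PMap C S)"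
  obtains \<sigma> \<phi> where "\<sigma> \<in> S" "\<phi> \<in> Arr C" "src C \<sigma> = src C \<phi>" "f = pmap C S \<sigma> \<phi>"
proof -
  obtain x where x: "x \<in> spans C S" "f = span_iso C S `` {x}"
    using assms by (auto simp: PMap_def elim: quotientE)
  obtain \<sigma> \<phi> where "x = (\<sigma>, \<phi>)" by (cases x)
  with x that[of \<sigma> \<phi>] show ?thesis by (auto simp: pmap_def spans_iff)
qed

lemma pmap_eqD:
  assumes "pmap C S \<sigma> \<phi> = pmap C S \<sigma>' \<phi>'" "(\<sigma>', \<phi>') \<in> spans C S" "(\<sigma>, \<phi>) \<in> spans C S"
  obtains i where "iso C i" "tgt C i = src C \<sigma>" "\<sigma>' = \<sigma> \<cdot> i" "\<phi>' = \<phi> \<cdot> i"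
  using assms mem_pmap_iff[of \<sigma> \<phi> "(\<sigma>', \<phi>')"] pmap_self[of \<sigma>' \<phi>'] by auto

lemma pmap_eqI:
  assumes "(\<sigma>, \<phi>) \<in> spans C S" "iso C i" "tgt C i = src C \<sigma>" "\<sigma>' = \<sigma> \<cdot> i" "\<phi>' = \<phi> \<cdot> i"
  shows "pmap C S \<sigma> \<phi> = pmap C S \<sigma>' \<phi>'"
  using pmap_of_mem(2)[OF pmap_Arr[OF assms(1)]] mem_pmap_iff[OF assms(1)] assms by auto

section \<open>Source, target, composition and order computed on representatives\<close>

lemma PMap_src_tgt:
  assumes "(\<sigma>, \<phi>) \<in> spans C S"
  shows "src (PMap C S) (pmap C S \<sigma> \<phi>) = tgt C \<sigma>" "tgt (PMap C S) (pmap C S \<sigma> \<phi>) = tgt C \<phi>"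
proof -
  have "(\<lambda>(\<sigma>, \<phi>). tgt C \<sigma>) ` pmap C S \<sigma> \<phi> = {tgt C \<sigma>}"
    "(\<lambda>(\<sigma>, \<phi>). tgt C \<phi>) ` pmap C S \<sigma> \<phi> = {tgt C \<phi>}"
    using assms pmap_self[OF assms] by (force simp: mem_pmap_iff spans_iff)+
  then show "src (PMap C S) (pmap C S \<sigma> \<phi>) = tgt C \<sigma>" "tgt (PMap C S) (pmap C S \<sigma> \<phi>) = tgt C \<phi>"
    by (simp_all add: PMap_def)
qed

text \<open>Any representatives and any pullback may be used. Other representatives differ by
  isomorphisms \<open>i\<close> and \<open>j\<close>, and the two pullbacks are compared by their
  universal properties; conversely an isomorphism of the apex is absorbed into the pullback.\<close>

lemma PMap_compose:
  assumes f: "(\<sigma>f, \<phi>f) \<in> spans C S" and g: "(\<sigma>g, \<phi>g) \<in> spans C S"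
    and P: "is_pullback C \<phi>f \<sigma>g p q"
  shows "pmap C S \<sigma>g \<phi>g \<cdot>\<^bsub>PMap C S\<^esub> pmap C S \<sigma>f \<phi>f = pmap C S (\<sigma>f \<cdot> p) (\<phi>g \<cdot> q)"
    "(\<sigma>f \<cdot> p, \<phi>g \<cdot> q) \<in> spans C S"
proof -
  note D = pullbackD[OF P]
  note fg = f[unfolded spans_iff] g[unfolded spans_iff]
  have "p \<in> S" using S_stable[OF _ P] fg by blast
  then show sp: "(\<sigma>f \<cdot> p, \<phi>g \<cdot> q) \<in> spans C S"
    using D fg by (auto simp: spans_iff intro!: S_compose)
  have "x \<in> pcompose C (pmap C S \<sigma>g \<phi>g) (pmap C S \<sigma>f \<phi>f) \<longleftrightarrow> x \<in> pmap C S (\<sigma>f \<cdot> p) (\<phi>g \<cdot> q)" for x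
  proof
    assume "x \<in> pcompose C (pmap C S \<sigma>g \<phi>g) (pmap C S \<sigma>f \<phi>f)"
    then obtain i j p1 q1 where i: "iso C i" "tgt C i = src C \<sigma>f" and j: "iso C j" "tgt C j = src C \<sigma>g"
      and Q: "is_pullback C (\<phi>f \<cdot> i) (\<sigma>g \<cdot> j) p1 q1"
      and x: "x = ((\<sigma>f \<cdot> i) \<cdot> p1, (\<phi>g \<cdot> j) \<cdot> q1)"
      unfolding pcompose_def mem_pmap_iff[OF f] mem_pmap_iff[OF g] by blast
    note E = pullbackD[OF Q]
    obtain i' where i': "iso C i'" "src C i' = tgt C i" "tgt C i' = src C i"
      "i' \<cdot> i = ide C (src C i)" "i \<cdot> i' = ide C (tgt C i)" using iso_inverse[OF i(1)] .
    obtain j' where j': "iso C j'" "src C j' = tgt C j" "tgt C j' = src C j"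
      "j' \<cdot> j = ide C (src C j)" "j \<cdot> j' = ide C (tgt C j)" using iso_inverse[OF j(1)] .
    have ci: "i \<cdot> (i' \<cdot> y) = y" if "y \<in> Arr C" "tgt C y = src C \<sigma>f" for y
      using assoc_Arr[of y i' i] that i i' by simp
    have ci': "i' \<cdot> (i \<cdot> y) = y" if "y \<in> Arr C" "tgt C y = src C i" for y
      using assoc_Arr[of y i i'] that i i' by simp
    have cj: "j \<cdot> (j' \<cdot> y) = y" if "y \<in> Arr C" "tgt C y = src C \<sigma>g" for y
      using assoc_Arr[of y j' j] that j j' by simp
    have cj': "j' \<cdot> (j \<cdot> y) = y" if "y \<in> Arr C" "tgt C y = src C j" for y
      using assoc_Arr[of y j j'] that j j' by simp
    have eq: "\<phi>f \<cdot> (i \<cdot> p1) = \<sigma>g \<cdot> (j \<cdot> q1)"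
      using E i j fg by simp
    \<comment> \<open>\<open>h\<close> and \<open>k\<close> are the comparison maps between the two
      apexes; the inverses of \<open>i\<close> and \<open>j\<close> translate a cone over one cospan
      into a cone over the other.\<close>
    obtain h where h: "h \<in> Arr C" "src C h = src C p1" "tgt C h = src C p"
      "p \<cdot> h = i \<cdot> p1" "q \<cdot> h = j \<cdot> q1"
      by (rule pullback_universal[OF P, of "i \<cdot> p1" "j \<cdot> q1"]) (simp_all add: eq D E i j fg)
    obtain k where k: "k \<in> Arr C" "src C k = src C p" "tgt C k = src C p1"
      "p1 \<cdot> k = i' \<cdot> p" "q1 \<cdot> k = j' \<cdot> q"
      by (rule pullback_universal[OF Q, of "i' \<cdot> p" "j' \<cdot> q"])
        (use D E i j i' j' fg in \<open>auto simp: ci cj\<close>)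
    \<comment> \<open>That \<open>h\<close> and \<open>k\<close> are mutually inverse is checked
      after composing with the two legs, which are jointly monic.\<close>
    have "h \<cdot> k = ide C (tgt C h)"
    proof (rule pullback_jointly_monic[OF P])
      show "p \<cdot> (h \<cdot> k) = p \<cdot> ide C (tgt C h)"
        using compose_eq_extend[OF h(4), of k] D E i fg h k by (simp add: ci)
      show "q \<cdot> (h \<cdot> k) = q \<cdot> ide C (tgt C h)"
        using compose_eq_extend[OF h(5), of k] D E j fg h k by (simp add: cj)
    qed (simp_all add: D E h k)
    moreover have "k \<cdot> h = ide C (src C h)"
    proof (rule pullback_jointly_monic[OF Q])
      show "p1 \<cdot> (k \<cdot> h) = p1 \<cdot> ide C (src C h)"
        using compose_eq_extend[OF k(4), of h] D E i i' fg h k by (simp add: ci')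
      show "q1 \<cdot> (k \<cdot> h) = q1 \<cdot> ide C (src C h)"
        using compose_eq_extend[OF k(5), of h] D E j j' fg h k by (simp add: cj')
    qed (simp_all add: D E h k)
    ultimately have "iso C h" by (intro isoI[of h k]) (simp_all add: h k)
    then show "x \<in> pmap C S (\<sigma>f \<cdot> p) (\<phi>g \<cdot> q)"
      using D E h i j fg x by (auto simp: mem_pmap_iff[OF sp] intro!: exI[of _ h])
  next
    assume "x \<in> pmap C S (\<sigma>f \<cdot> p) (\<phi>g \<cdot> q)"
    then obtain i where i: "iso C i" "tgt C i = src C p" "x = ((\<sigma>f \<cdot> p) \<cdot> i, (\<phi>g \<cdot> q) \<cdot> i)"
      using D fg by (auto simp: mem_pmap_iff[OF sp])
    then have "x = (\<sigma>f \<cdot> (p \<cdot> i), \<phi>g \<cdot> (q \<cdot> i))" using D fg by auto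
    then show "x \<in> pcompose C (pmap C S \<sigma>g \<phi>g) (pmap C S \<sigma>f \<phi>f)"
      unfolding pcompose_def
      using pmap_self[OF f] pmap_self[OF g] pullback_compose_iso[OF P i(1,2)] by blast
  qed
  then show "pmap C S \<sigma>g \<phi>g \<cdot>\<^bsub>PMap C S\<^esub> pmap C S \<sigma>f \<phi>f = pmap C S (\<sigma>f \<cdot> p) (\<phi>g \<cdot> q)"
    by (auto simp: PMap_def)
qed

text \<open>The witness of the order on partial maps lies in \<open>S\<close> automatically, by \<open>S_cancel\<close>.\<close>

lemma PMap_leq_iff:
  assumes f: "(\<sigma>f, \<phi>f) \<in> spans C S" and g: "(\<sigma>g, \<phi>g) \<in> spans C S"
  shows "pmap C S \<sigma>f \<phi>f \<sqsubseteq>\<^bsub>PMap C S\<^esub> pmap C S \<sigma>g \<phi>g \<longleftrightarrow>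
    (\<exists>s. s \<in> Arr C \<and> src C s = src C \<sigma>f \<and> tgt C s = src C \<sigma>g \<and> \<sigma>f = \<sigma>g \<cdot> s \<and> \<phi>f \<sqsubseteq> \<phi>g \<cdot> s)"
    (is "?L \<longleftrightarrow> ?R")
proof
  note fg = f[unfolded spans_iff] g[unfolded spans_iff]
  assume ?L
  then obtain i j s where i: "iso C i" "tgt C i = src C \<sigma>f" and j: "iso C j" "tgt C j = src C \<sigma>g"
    and s: "s \<in> S" "s \<in> hom C (src C (\<sigma>f \<cdot> i)) (src C (\<sigma>g \<cdot> j))"
    "\<sigma>f \<cdot> i = (\<sigma>g \<cdot> j) \<cdot> s" "\<phi>f \<cdot> i \<sqsubseteq> (\<phi>g \<cdot> j) \<cdot> s"
    unfolding PMap_def pleq_def ocat.simps mem_pmap_iff[OF f] mem_pmap_iff[OF g] by blast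
  obtain i' where i': "iso C i'" "src C i' = tgt C i" "tgt C i' = src C i"
    "i' \<cdot> i = ide C (src C i)" "i \<cdot> i' = ide C (tgt C i)" using iso_inverse[OF i(1)] .
  have ss: "s \<in> Arr C" "src C s = src C i" "tgt C s = src C j"
    using s(2) fg i j by (auto simp: hom_def)
  \<comment> \<open>The witness between the given representatives is conjugated by the two
    reparametrisations, which gives \<open>j \<cdot> (s \<cdot> i')\<close> as the witness for the
    chosen ones.\<close>
  have "\<sigma>f = \<sigma>f \<cdot> (i \<cdot> i')" using i i' fg by simp
  also have "\<dots> = (\<sigma>f \<cdot> i) \<cdot> i'" using i i' fg by (simp del: i'(5))
  also have "\<dots> = \<sigma>g \<cdot> (j \<cdot> (s \<cdot> i'))" using s(3) i i' j ss fg by simp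
  finally have 1: "\<sigma>f = \<sigma>g \<cdot> (j \<cdot> (s \<cdot> i'))" .
  have "\<phi>f = \<phi>f \<cdot> (i \<cdot> i')" using i i' fg by simp
  also have "\<dots> = (\<phi>f \<cdot> i) \<cdot> i'" using i i' fg assoc_Arr[of i' i \<phi>f] by simp
  also have "\<dots> \<sqsubseteq> ((\<phi>g \<cdot> j) \<cdot> s) \<cdot> i'"
    by (rule leq_compose_right) (use s(4) i i' fg in auto)
  also have "\<dots> = \<phi>g \<cdot> (j \<cdot> (s \<cdot> i'))" using i i' j ss fg by simp
  finally have 2: "\<phi>f \<sqsubseteq> \<phi>g \<cdot> (j \<cdot> (s \<cdot> i'))" .
  show ?R by (rule exI[of _ "j \<cdot> (s \<cdot> i')"]) (simp_all add: 1 2 i i' j ss)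
next
  note fg = f[unfolded spans_iff] g[unfolded spans_iff]
  assume ?R
  then obtain s where s: "s \<in> Arr C" "src C s = src C \<sigma>f" "tgt C s = src C \<sigma>g" "\<sigma>f = \<sigma>g \<cdot> s" "\<phi>f \<sqsubseteq> \<phi>g \<cdot> s"
    by blast
  then have "s \<in> S" using S_cancel[of \<sigma>g s] fg by auto
  moreover have "s \<in> hom C (src C \<sigma>f) (src C \<sigma>g)" using s by (simp add: hom_def)
  moreover note pmap_self[OF f] pmap_self[OF g] s pmap_Arr[OF f] pmap_Arr[OF g]
  ultimately show ?L unfolding PMap_def pleq_def ocat.simps by blast
qed


section \<open>The Ord-enriched category of partial maps\<close>

lemma PMap_Obj [simp]: "Obj (PMap C S) = Obj C"
  by (simp add: PMap_def)

lemma PMap_ide: "ide (PMap C S) A = pmap C S (ide C A) (ide C A)"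
  by (simp add: PMap_def)

lemma PMap_hom_cases:
  assumes "f \<in> hom (PMap C S) A B"
  obtains \<sigma> \<phi> where "\<sigma> \<in> S" "\<phi> \<in> Arr C" "src C \<sigma> = src C \<phi>" "f = pmap C S \<sigma> \<phi>"
    "tgt C \<sigma> = A" "tgt C \<phi> = B" "(\<sigma>, \<phi>) \<in> spans C S"
  using assms PMap_src_tgt by (auto simp: hom_def spans_iff elim!: pmap_cases)

lemma pmap_hom_iff:
  assumes "(\<sigma>, \<phi>) \<in> spans C S"
  shows "pmap C S \<sigma> \<phi> \<in> hom (PMap C S) A B \<longleftrightarrow> tgt C \<sigma> = A \<and> tgt C \<phi> = B"
  using assms PMap_src_tgt[OF assms] pmap_Arr[OF assms] by (simp add: hom_def)

lemma PMap_ord_category: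
  assumes "monotone_composition (PMap C S)"
  shows "ord_category (PMap C S)"
proof
  fix f assume "f \<in> Arr (PMap C S)"
  then obtain \<sigma> \<phi> where f: "\<sigma> \<in> S" "\<phi> \<in> Arr C" "src C \<sigma> = src C \<phi>" "f = pmap C S \<sigma> \<phi>"
    by (rule pmap_cases)
  then have sp: "(\<sigma>, \<phi>) \<in> spans C S" by (simp add: spans_iff)
  show "src (PMap C S) f \<in> Obj (PMap C S)" "tgt (PMap C S) f \<in> Obj (PMap C S)"
    using f PMap_src_tgt[OF sp] by simp_all
  have "f \<sqsubseteq>\<^bsub>PMap C S\<^esub> f \<longleftrightarrow>
      (\<exists>s. s \<in> Arr C \<and> src C s = src C \<sigma> \<and> tgt C s = src C \<sigma> \<and> \<sigma> = \<sigma> \<cdot> s \<and> \<phi> \<sqsubseteq> \<phi> \<cdot> s)"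
    using PMap_leq_iff[OF sp sp] f by simp
  then show "f \<sqsubseteq>\<^bsub>PMap C S\<^esub> f"
    using f by (auto simp: leq_refl intro!: exI[of _ "ide C (src C \<sigma>)"])
next
  fix A assume "A \<in> Obj (PMap C S)"
  then show "ide (PMap C S) A \<in> hom (PMap C S) A A"
    by (simp add: PMap_ide pmap_hom_iff spans_iff)
next
  fix f g A B D assume "f \<in> hom (PMap C S) A B" "g \<in> hom (PMap C S) B D"
  obtain \<sigma>f \<phi>f where f: "\<sigma>f \<in> S" "\<phi>f \<in> Arr C" "src C \<sigma>f = src C \<phi>f" "f = pmap C S \<sigma>f \<phi>f"
    "tgt C \<sigma>f = A" "tgt C \<phi>f = B" "(\<sigma>f, \<phi>f) \<in> spans C S"
    using PMap_hom_cases[OF \<open>f \<in> hom (PMap C S) A B\<close>] .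
  obtain \<sigma>g \<phi>g where g: "\<sigma>g \<in> S" "\<phi>g \<in> Arr C" "src C \<sigma>g = src C \<phi>g" "g = pmap C S \<sigma>g \<phi>g"
    "tgt C \<sigma>g = B" "tgt C \<phi>g = D" "(\<sigma>g, \<phi>g) \<in> spans C S"
    using PMap_hom_cases[OF \<open>g \<in> hom (PMap C S) B D\<close>] .
  obtain p q where P: "is_pullback C \<phi>f \<sigma>g p q"
    using S_has_pullbacks[of \<sigma>g \<phi>f] f g by auto
  show "g \<cdot>\<^bsub>PMap C S\<^esub> f \<in> hom (PMap C S) A D"
    using PMap_compose[OF f(7) g(7) P] pullbackD[OF P] f g by (simp add: pmap_hom_iff)
next
  fix f A B assume "f \<in> hom (PMap C S) A B"
  then obtain \<sigma> \<phi> where f: "\<sigma> \<in> S" "\<phi> \<in> Arr C" "src C \<sigma> = src C \<phi>" "f = pmap C S \<sigma> \<phi>"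
    "tgt C \<sigma> = A" "tgt C \<phi> = B" "(\<sigma>, \<phi>) \<in> spans C S"
    by (rule PMap_hom_cases)
  have i: "(ide C A, ide C A) \<in> spans C S" "(ide C B, ide C B) \<in> spans C S"
    using f by (auto simp: spans_iff)
  show "f \<cdot>\<^bsub>PMap C S\<^esub> ide (PMap C S) A = f"
    using PMap_compose[OF i(1) f(7) pullback_ide_left] f by (auto simp: PMap_ide)
  show "ide (PMap C S) B \<cdot>\<^bsub>PMap C S\<^esub> f = f"
    using PMap_compose[OF f(7) i(2) pullback_ide_right] f by (auto simp: PMap_ide)
next
  fix f g h A B D E
  assume "f \<in> hom (PMap C S) A B" "g \<in> hom (PMap C S) B D" "h \<in> hom (PMap C S) D E"
  obtain \<sigma>f \<phi>f where f: "\<sigma>f \<in> S" "\<phi>f \<in> Arr C" "src C \<sigma>f = src C \<phi>f" "f = pmap C S \<sigma>f \<phi>f"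
    "tgt C \<sigma>f = A" "tgt C \<phi>f = B" "(\<sigma>f, \<phi>f) \<in> spans C S"
    using PMap_hom_cases[OF \<open>f \<in> hom (PMap C S) A B\<close>] .
  obtain \<sigma>g \<phi>g where g: "\<sigma>g \<in> S" "\<phi>g \<in> Arr C" "src C \<sigma>g = src C \<phi>g" "g = pmap C S \<sigma>g \<phi>g"
    "tgt C \<sigma>g = B" "tgt C \<phi>g = D" "(\<sigma>g, \<phi>g) \<in> spans C S"
    using PMap_hom_cases[OF \<open>g \<in> hom (PMap C S) B D\<close>] .
  obtain \<sigma>h \<phi>h where h: "\<sigma>h \<in> S" "\<phi>h \<in> Arr C" "src C \<sigma>h = src C \<phi>h" "h = pmap C S \<sigma>h \<phi>h"
    "tgt C \<sigma>h = D" "tgt C \<phi>h = E" "(\<sigma>h, \<phi>h) \<in> spans C S"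
    using PMap_hom_cases[OF \<open>h \<in> hom (PMap C S) D E\<close>] .
  obtain p q where P: "is_pullback C \<phi>f \<sigma>g p q"
    using S_has_pullbacks[of \<sigma>g \<phi>f] f g by auto
  obtain p2 q2 where Q: "is_pullback C \<phi>g \<sigma>h p2 q2"
    using S_has_pullbacks[of \<sigma>h \<phi>g] g h by auto
  note D = pullbackD[OF P] and D2 = pullbackD[OF Q]
  \<comment> \<open>The pullback of \<open>p2\<close> along \<open>q\<close> is pasted to
    \<open>P\<close> for one bracketing and to \<open>Q\<close> for the other, so a single apex
    serves as the domain of both threefold composites.\<close>
  have "p2 \<in> S" using S_stable[OF h(1) Q] .
  then obtain a b where R: "is_pullback C q p2 a b"
    using S_has_pullbacks[of p2 q] D D2 g by auto
  note D3 = pullbackD[OF R]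
  note gf = PMap_compose[OF f(7) g(7) P] and hg = PMap_compose[OF g(7) h(7) Q]
  have "(h \<cdot>\<^bsub>PMap C S\<^esub> g) \<cdot>\<^bsub>PMap C S\<^esub> f = pmap C S (\<sigma>f \<cdot> (p \<cdot> a)) ((\<phi>h \<cdot> q2) \<cdot> b)"
    using PMap_compose(1)[OF f(7) hg(2) pullback_pasting[OF P R]] hg(1) f(4) g(4) h(4) by simp
  also have "\<dots> = pmap C S ((\<sigma>f \<cdot> p) \<cdot> a) (\<phi>h \<cdot> (q2 \<cdot> b))"
    using D D2 D3 f(1-3) g(1-3) h(1-3) by simp
  also have "\<dots> = h \<cdot>\<^bsub>PMap C S\<^esub> (g \<cdot>\<^bsub>PMap C S\<^esub> f)"
    using PMap_compose(1)[OF gf(2) h(7) pullback_pasting'[OF Q R]] gf(1) f(4) g(4) h(4) by simp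
  finally show "(h \<cdot>\<^bsub>PMap C S\<^esub> g) \<cdot>\<^bsub>PMap C S\<^esub> f = h \<cdot>\<^bsub>PMap C S\<^esub> (g \<cdot>\<^bsub>PMap C S\<^esub> f)" .
next
  fix f g assume le: "f \<sqsubseteq>\<^bsub>PMap C S\<^esub> g"
  then have arr: "f \<in> Arr (PMap C S)" "g \<in> Arr (PMap C S)"
    by (auto simp: PMap_def pleq_def)
  obtain \<sigma>f \<phi>f where f: "\<sigma>f \<in> S" "\<phi>f \<in> Arr C" "src C \<sigma>f = src C \<phi>f" "f = pmap C S \<sigma>f \<phi>f"
    using pmap_cases[OF arr(1)] .
  obtain \<sigma>g \<phi>g where g: "\<sigma>g \<in> S" "\<phi>g \<in> Arr C" "src C \<sigma>g = src C \<phi>g" "g = pmap C S \<sigma>g \<phi>g"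
    using pmap_cases[OF arr(2)] .
  have sf: "(\<sigma>f, \<phi>f) \<in> spans C S" and sg: "(\<sigma>g, \<phi>g) \<in> spans C S"
    using f g by (auto simp: spans_iff)
  obtain s where s: "s \<in> Arr C" "src C s = src C \<sigma>f" "tgt C s = src C \<sigma>g" "\<sigma>f = \<sigma>g \<cdot> s" "\<phi>f \<sqsubseteq> \<phi>g \<cdot> s"
    using le f g PMap_leq_iff[OF sf sg] by auto
  have "tgt C \<sigma>f = tgt C \<sigma>g" "tgt C \<phi>f = tgt C \<phi>g"
    using s leqD[OF s(5)] g by auto
  then show "\<exists>A B. f \<in> hom (PMap C S) A B \<and> g \<in> hom (PMap C S) A B"
    using f(4) g(4) sf sg by (auto simp: pmap_hom_iff)
  {
    assume "g \<sqsubseteq>\<^bsub>PMap C S\<^esub> f"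
    then obtain t where t: "t \<in> Arr C" "src C t = src C \<sigma>g" "tgt C t = src C \<sigma>f"
      "\<sigma>g = \<sigma>f \<cdot> t" "\<phi>g \<sqsubseteq> \<phi>f \<cdot> t"
      using f g PMap_leq_iff[OF sg sf] by auto
    \<comment> \<open>Both domain inclusions are monic, so the witnesses \<open>s\<close> and
      \<open>t\<close> of the two inequalities are mutually inverse. What remains is antisymmetry in
      \<open>C\<close> for the right legs.\<close>
    have "\<sigma>f \<cdot> (t \<cdot> s) = (\<sigma>f \<cdot> t) \<cdot> s" using f(1) s(1-3) t(1-3) by simp
    also have "\<dots> = \<sigma>f" using s(4) t(4) by simp
    finally have ts: "t \<cdot> s = ide C (src C \<sigma>f)"
      using S_monicD[of \<sigma>f "t \<cdot> s" "ide C (src C \<sigma>f)"] f(1) s(1-3) t(1-3) by simp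
    have "\<sigma>g \<cdot> (s \<cdot> t) = (\<sigma>g \<cdot> s) \<cdot> t" using g(1) s(1-3) t(1-3) by simp
    also have "\<dots> = \<sigma>g" using s(4) t(4) by simp
    finally have st: "s \<cdot> t = ide C (src C \<sigma>g)"
      using S_monicD[of \<sigma>g "s \<cdot> t" "ide C (src C \<sigma>g)"] g(1) s(1-3) t(1-3) by simp
    have "iso C s" by (rule isoI[of s t]) (simp_all add: s(1-3) t(1-3) st ts)
    have "\<phi>g \<cdot> s \<sqsubseteq> (\<phi>f \<cdot> t) \<cdot> s"
      by (rule leq_compose_right) (use t(5) s(1-3) g(3) in simp_all)
    also have "(\<phi>f \<cdot> t) \<cdot> s = \<phi>f \<cdot> (t \<cdot> s)" using f(1-3) s(1-3) t(1-3) by simp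
    also have "\<dots> = \<phi>f" using f(2,3) ts by simp
    finally have "\<phi>f = \<phi>g \<cdot> s" using s(5) leq_antisym by blast
    then show "f = g"
      using pmap_eqI[OF sg \<open>iso C s\<close> s(3,4), of \<phi>f] f(4) g(4) by simp
  }
  fix h assume le': "g \<sqsubseteq>\<^bsub>PMap C S\<^esub> h"
  then have "h \<in> Arr (PMap C S)" by (auto simp: PMap_def pleq_def)
  then obtain \<sigma>h \<phi>h where h: "\<sigma>h \<in> S" "\<phi>h \<in> Arr C" "src C \<sigma>h = src C \<phi>h" "h = pmap C S \<sigma>h \<phi>h"
    by (rule pmap_cases)
  have sh: "(\<sigma>h, \<phi>h) \<in> spans C S" using h by (simp add: spans_iff)
  obtain t where t: "t \<in> Arr C" "src C t = src C \<sigma>g" "tgt C t = src C \<sigma>h" "\<sigma>g = \<sigma>h \<cdot> t" "\<phi>g \<sqsubseteq> \<phi>h \<cdot> t"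
    using le' g h PMap_leq_iff[OF sg sh] by auto
  have "\<phi>g \<cdot> s \<sqsubseteq> (\<phi>h \<cdot> t) \<cdot> s"
    by (rule leq_compose_right) (use t(5) s(1-3) g(3) in simp_all)
  also have "(\<phi>h \<cdot> t) \<cdot> s = \<phi>h \<cdot> (t \<cdot> s)" using h(1-3) s(1-3) t(1-3) by simp
  finally have "\<phi>f \<sqsubseteq> \<phi>h \<cdot> (t \<cdot> s)" using s(5) leq_trans by blast
  moreover have "\<sigma>f = \<sigma>h \<cdot> (t \<cdot> s)"
    unfolding s(4) t(4) using h(1) s(1-3) t(1-3) by simp
  moreover have "t \<cdot> s \<in> Arr C" "src C (t \<cdot> s) = src C \<sigma>f" "tgt C (t \<cdot> s) = src C \<sigma>h"
    using s(1-3) t(1-3) by simp_all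
  ultimately show "f \<sqsubseteq>\<^bsub>PMap C S\<^esub> h"
    using PMap_leq_iff[OF sf sh] f(4) h(4) by blast
qed (fact assms)

end


section \<open>Direct images and restrictions\<close>

locale partial_maps = class_of_subobjects C S
  for C :: "('o, 'm) ocat" (structure) and S :: "'m set" +
  assumes PMap_monotone: "monotone_composition (PMap C S)"
begin

sublocale P: ord_category "PMap C S"
  by (rule PMap_ord_category[OF PMap_monotone])

abbreviation P_compose (infixr "\<bullet>" 70) where "g \<bullet> f \<equiv> g \<cdot>\<^bsub>PMap C S\<^esub> f"
abbreviation P_leq (infix "\<preceq>" 50) where "f \<preceq> g \<equiv> f \<sqsubseteq>\<^bsub>PMap C S\<^esub> g"

text \<open>The total map \<open>a\<^sub>*\<close> and, for \<open>s\<close> in \<open>S\<close>, the partial map \<open>s\<^sup>*\<close> right adjoint to \<open>s\<^sub>*\<close>.\<close>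

definition lower :: "'m \<Rightarrow> ('m \<times> 'm) set" where
  "lower a = pmap C S (ide C (src C a)) a"

definition upper :: "'m \<Rightarrow> ('m \<times> 'm) set" where
  "upper s = pmap C S s (ide C (src C s))"

lemma lower_span: "a \<in> Arr C \<Longrightarrow> (ide C (src C a), a) \<in> spans C S"
  by (simp add: spans_iff)

lemma upper_span: "s \<in> S \<Longrightarrow> (s, ide C (src C s)) \<in> spans C S"
  by (simp add: spans_iff)

lemma lower_Arr [simp]:
  assumes "a \<in> Arr C"
  shows "lower a \<in> Arr (PMap C S)" "src (PMap C S) (lower a) = src C a"
    "tgt (PMap C S) (lower a) = tgt C a"
  using assms pmap_Arr[OF lower_span] PMap_src_tgt[OF lower_span] by (simp_all add: lower_def)

lemma upper_Arr [simp]: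
  assumes "s \<in> S"
  shows "upper s \<in> Arr (PMap C S)" "src (PMap C S) (upper s) = tgt C s"
    "tgt (PMap C S) (upper s) = src C s"
  using assms pmap_Arr[OF upper_span] PMap_src_tgt[OF upper_span] by (simp_all add: upper_def)

text \<open>The pullback runs along an identity, so the domain is untouched. With the mirror image
  \<open>pmap_compose_upper\<close>, most composites of partial maps can be evaluated without
  constructing a pullback.\<close>

lemma lower_compose_pmap:
  assumes "(\<sigma>, \<phi>) \<in> spans C S" "b \<in> Arr C" "src C b = tgt C \<phi>"
  shows "lower b \<bullet> pmap C S \<sigma> \<phi> = pmap C S \<sigma> (b \<cdot> \<phi>)"
proof -
  have sp: "\<sigma> \<in> S" "\<phi> \<in> Arr C" "src C \<sigma> = src C \<phi>" using assms(1) by (simp_all add: spans_iff)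
  show ?thesis
    using PMap_compose(1)[OF assms(1) lower_span[OF assms(2)] pullback_ide_right[OF sp(2) assms(3)]] sp
    by (simp add: lower_def)
qed

lemma pmap_compose_upper:
  assumes "(\<sigma>, \<phi>) \<in> spans C S" "\<tau> \<in> S" "src C \<tau> = tgt C \<sigma>"
  shows "pmap C S \<sigma> \<phi> \<bullet> upper \<tau> = pmap C S (\<tau> \<cdot> \<sigma>) \<phi>"
proof -
  have sp: "\<sigma> \<in> S" "\<phi> \<in> Arr C" "src C \<sigma> = src C \<phi>" using assms(1) by (simp_all add: spans_iff)
  show ?thesis
    using PMap_compose(1)[OF upper_span[OF assms(2)] assms(1) pullback_ide_left[OF S_Arr[OF sp(1)] assms(3)]] sp
    by (simp add: upper_def)
qed

lemma lower_compose_upper: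
  assumes "\<sigma> \<in> S" "\<phi> \<in> Arr C" "src C \<sigma> = src C \<phi>"
  shows "lower \<phi> \<bullet> upper \<sigma> = pmap C S \<sigma> \<phi>"
  using lower_compose_pmap[OF upper_span[OF assms(1)], of \<phi>] assms by (simp add: upper_def)

lemma lower_compose:
  assumes "a \<in> Arr C" "b \<in> Arr C" "tgt C a = src C b"
  shows "lower (b \<cdot> a) = lower b \<bullet> lower a"
  using lower_compose_pmap[OF lower_span[OF assms(1)], of b] assms by (simp add: lower_def)

lemma lower_ide: "A \<in> Obj C \<Longrightarrow> lower (ide C A) = ide (PMap C S) A"
  by (simp add: lower_def PMap_ide)

lemma lower_mono:
  assumes "a \<sqsubseteq> b"
  shows "lower a \<preceq> lower b"
proof -
  note D = leqD[OF assms]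
  have "\<exists>s. s \<in> Arr C \<and> src C s = src C (ide C (src C a)) \<and> tgt C s = src C (ide C (src C b)) \<and>
      ide C (src C a) = ide C (src C b) \<cdot> s \<and> a \<sqsubseteq> b \<cdot> s"
    by (rule exI[of _ "ide C (src C b)"]) (use D assms in simp)
  then show ?thesis
    unfolding lower_def PMap_leq_iff[OF lower_span[OF D(1)] lower_span[OF D(2)]] .
qed

text \<open>The composite is formed over the kernel pair of \<open>s\<close>, which is trivial
  because \<open>s\<close> is monic; hence the unit of the adjunction is an equality.\<close>

lemma upper_compose_lower:
  assumes "s \<in> S"
  shows "upper s \<bullet> lower s = ide (PMap C S) (src C s)"
  using PMap_compose(1)[OF lower_span upper_span pullback_monic_self[OF S_monic]] assms
  by (simp add: upper_def lower_def PMap_ide)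

lemma lower_compose_upper_le:
  assumes "s \<in> S"
  shows "lower s \<bullet> upper s \<preceq> ide (PMap C S) (tgt C s)"
proof -
  have sp: "(s, s) \<in> spans C S" "(ide C (tgt C s), ide C (tgt C s)) \<in> spans C S"
    using assms by (auto simp: spans_iff)
  have "\<exists>t. t \<in> Arr C \<and> src C t = src C s \<and> tgt C t = src C (ide C (tgt C s)) \<and>
      s = ide C (tgt C s) \<cdot> t \<and> s \<sqsubseteq> ide C (tgt C s) \<cdot> t"
    by (rule exI[of _ s]) (use assms in \<open>simp add: leq_refl\<close>)
  then show ?thesis
    using PMap_leq_iff[OF sp] assms by (simp add: lower_compose_upper PMap_ide)
qed

section \<open>Normal forms for total maps and for members of \<open>PLA\<close>\<close>

lemma Tot_iff: "g \<in> Tot C S \<longleftrightarrow> (\<exists>\<gamma> \<in> Arr C. g = lower \<gamma>)"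
proof
  assume "g \<in> Tot C S"
  then obtain \<sigma> \<phi> where g: "g \<in> Arr (PMap C S)" "(\<sigma>, \<phi>) \<in> g" "iso C \<sigma>"
    by (auto simp: Tot_def)
  note sp = pmap_of_mem[OF g(1,2)]
  obtain j where j: "iso C j" "src C j = tgt C \<sigma>" "tgt C j = src C \<sigma>"
    "j \<cdot> \<sigma> = ide C (src C \<sigma>)" "\<sigma> \<cdot> j = ide C (tgt C \<sigma>)" using iso_inverse[OF g(3)] .
  have a: "\<phi> \<cdot> j \<in> Arr C" "src C (\<phi> \<cdot> j) = tgt C \<sigma>"
    using j sp(1) by (auto simp: spans_iff)
  \<comment> \<open>Reparametrising along the inverse \<open>j\<close> of \<open>\<sigma>\<close>
    turns the domain inclusion into an identity.\<close>
  have "g = pmap C S (\<sigma> \<cdot> j) (\<phi> \<cdot> j)"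
    using pmap_eqI[OF sp(1) j(1,3)] sp(2) by simp
  then have "g = lower (\<phi> \<cdot> j)" unfolding lower_def a(2) j(5) .
  then show "\<exists>\<gamma> \<in> Arr C. g = lower \<gamma>" using a(1) by blast
next
  assume "\<exists>\<gamma> \<in> Arr C. g = lower \<gamma>"
  then obtain \<gamma> where \<gamma>: "\<gamma> \<in> Arr C" "g = lower \<gamma>" by blast
  have "iso C (ide C (src C \<gamma>))" using \<gamma> by simp
  then show "g \<in> Tot C S"
    using pmap_self[OF lower_span[OF \<gamma>(1)]] \<gamma> lower_Arr(1) unfolding Tot_def lower_def by blast
qed

lemma PLA_cases:
  assumes "f \<in> PLA C S"
  obtains \<tau> \<sigma> \<psi> where "\<tau> \<in> S" "\<sigma> \<in> S" "left_adjoint C \<psi>" "\<psi> \<in> Arr C" "src C \<psi> = src C \<tau>"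
    "tgt C \<psi> = src C \<sigma>" "f = lower \<sigma> \<bullet> (lower \<psi> \<bullet> upper \<tau>)"
proof -
  obtain \<tau> \<phi> \<sigma> \<psi> where f: "f \<in> Arr (PMap C S)" "(\<tau>, \<phi>) \<in> f" "\<sigma> \<in> S" "\<psi> \<in> hom C (src C \<phi>) (src C \<sigma>)"
    "left_adjoint C \<psi>" "\<phi> = \<sigma> \<cdot> \<psi>"
    using assms unfolding PLA_def by blast
  have sp: "\<tau> \<in> S" "\<phi> \<in> Arr C" "src C \<tau> = src C \<phi>" "f = pmap C S \<tau> \<phi>"
    using pmap_of_mem[OF f(1,2)] by (simp_all add: spans_iff)
  have \<psi>: "\<psi> \<in> Arr C" "src C \<psi> = src C \<tau>" "tgt C \<psi> = src C \<sigma>"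
    using f(4) sp(3) by (simp_all add: hom_def)
  have "f = (lower \<sigma> \<bullet> lower \<psi>) \<bullet> upper \<tau>"
    using sp f(3,6) \<psi> lower_compose_upper[OF sp(1-3)] lower_compose[of \<psi> \<sigma>] by simp
  also have "\<dots> = lower \<sigma> \<bullet> (lower \<psi> \<bullet> upper \<tau>)"
    by (rule P.assoc_Arr) (simp_all add: f(3) sp(1) \<psi>)
  finally show ?thesis using that sp(1) f(3,5) \<psi> by blast
qed

lemma PLA_I:
  assumes "\<tau> \<in> S" "\<sigma> \<in> S" "left_adjoint C \<psi>" "src C \<psi> = src C \<tau>" "tgt C \<psi> = src C \<sigma>"
  shows "pmap C S \<tau> (\<sigma> \<cdot> \<psi>) \<in> PLA C S"
proof -
  have \<psi>: "\<psi> \<in> Arr C" using assms(3) by (simp add: left_adjoint_def)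
  then have sp: "(\<tau>, \<sigma> \<cdot> \<psi>) \<in> spans C S" using assms by (simp add: spans_iff)
  have "\<psi> \<in> hom C (src C (\<sigma> \<cdot> \<psi>)) (src C \<sigma>)" using \<psi> assms by (simp add: hom_def)
  then show ?thesis
    using pmap_self[OF sp] pmap_Arr[OF sp] assms(2,3) unfolding PLA_def by blast
qed

text \<open>The right leg is an identity, which factors as an identity in \<open>S\<close> after an
  identity regarded as a left adjoint.\<close>

lemma upper_PLA:
  assumes "s \<in> S"
  shows "upper s \<in> PLA C S"
proof -
  let ?i = "ide C (src C s)"
  have "?i \<in> hom C (tgt C ?i) (src C ?i)" "ide C (src C ?i) \<sqsubseteq> ?i \<cdot> ?i" "?i \<cdot> ?i \<sqsubseteq> ide C (tgt C ?i)"
    using assms by (simp_all add: hom_def leq_refl)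
  moreover have "?i \<in> Arr C" using assms by simp
  ultimately have "left_adjoint C ?i"
    unfolding left_adjoint_def by blast
  then show ?thesis
    using PLA_I[of s ?i ?i] assms by (simp add: upper_def)
qed

section \<open>Lax orthogonality of the two classes\<close>

text \<open>Composing with the total map \<open>lower \<gamma>\<close> keeps the domain of
  \<open>u\<close>, so the witness \<open>s\<close> of the inequality writes
  \<open>\<sigma>u\<close> as \<open>\<sigma>\<close> after \<open>\<sigma>k \<cdot> s\<close>. The
  latter lies in \<open>S\<close> by \<open>S_cancel\<close> and is the domain inclusion of
  \<open>u'\<close>.\<close>

lemma factors_through_upper:
  assumes u: "u \<in> Arr (PMap C S)" and k: "k \<in> Arr (PMap C S)" and "\<sigma> \<in> S" "\<gamma> \<in> Arr C"
    and "tgt (PMap C S) u = src C \<gamma>" "src (PMap C S) k = src C \<sigma>"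
    and le: "lower \<gamma> \<bullet> u \<preceq> k \<bullet> upper \<sigma>"
  obtains u' where "u' \<in> Arr (PMap C S)" "src (PMap C S) u' = src C \<sigma>"
    "tgt (PMap C S) u' = tgt (PMap C S) u" "u = u' \<bullet> upper \<sigma>"
proof -
  obtain \<sigma>u \<phi>u where uu: "\<sigma>u \<in> S" "\<phi>u \<in> Arr C" "src C \<sigma>u = src C \<phi>u" "u = pmap C S \<sigma>u \<phi>u"
    using pmap_cases[OF u] .
  obtain \<sigma>k \<phi>k where kk: "\<sigma>k \<in> S" "\<phi>k \<in> Arr C" "src C \<sigma>k = src C \<phi>k" "k = pmap C S \<sigma>k \<phi>k"
    using pmap_cases[OF k] .
  have su: "(\<sigma>u, \<phi>u) \<in> spans C S" and sk: "(\<sigma>k, \<phi>k) \<in> spans C S"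
    using uu kk by (simp_all add: spans_iff)
  have t: "src C \<gamma> = tgt C \<phi>u" "src C \<sigma> = tgt C \<sigma>k"
    using assms(5,6) uu(4) kk(4) PMap_src_tgt[OF su] PMap_src_tgt[OF sk] by simp_all
  have s1: "(\<sigma>u, \<gamma> \<cdot> \<phi>u) \<in> spans C S" and s2: "(\<sigma> \<cdot> \<sigma>k, \<phi>k) \<in> spans C S"
    using uu(1-3) kk(1-3) t assms(3,4) by (simp_all add: spans_iff S_compose)
  have "pmap C S \<sigma>u (\<gamma> \<cdot> \<phi>u) \<preceq> pmap C S (\<sigma> \<cdot> \<sigma>k) \<phi>k"
    using le lower_compose_pmap[OF su assms(4) t(1)] pmap_compose_upper[OF sk assms(3) t(2)]
    by (simp add: uu(4) kk(4))
  then obtain s where s: "s \<in> Arr C" "src C s = src C \<sigma>u" "tgt C s = src C (\<sigma> \<cdot> \<sigma>k)"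
    "\<sigma>u = (\<sigma> \<cdot> \<sigma>k) \<cdot> s"
    unfolding PMap_leq_iff[OF s1 s2] by blast
  have s': "tgt C s = src C \<sigma>k" using s(3) assms(3) kk(1) t by simp
  have eq: "\<sigma>u = \<sigma> \<cdot> (\<sigma>k \<cdot> s)"
    unfolding s(4) using s(1) s' assms(3) kk(1) t by simp
  have ks: "\<sigma>k \<cdot> s \<in> Arr C" "src C (\<sigma>k \<cdot> s) = src C \<phi>u" "tgt C (\<sigma>k \<cdot> s) = src C \<sigma>"
    using s(1,2) s' kk(1) t uu(3) by simp_all
  have "\<sigma>k \<cdot> s \<in> S"
    using S_cancel[OF _ assms(3) ks(1) ks(3)] uu(1) eq by simp
  then have sp: "(\<sigma>k \<cdot> s, \<phi>u) \<in> spans C S" using ks uu(2) by (simp add: spans_iff)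
  have "u = pmap C S (\<sigma>k \<cdot> s) \<phi>u \<bullet> upper \<sigma>"
    using pmap_compose_upper[OF sp assms(3)] ks(3) uu(4) eq by simp
  then show ?thesis
    using that[OF pmap_Arr[OF sp]] PMap_src_tgt[OF sp] PMap_src_tgt[OF su] ks(3) uu(4) by simp
qed

lemma PLA_lax_orthogonal_Tot:
  assumes "f \<in> PLA C S" "g \<in> Tot C S"
  shows "lax_orthogonal (PMap C S) f g"
  unfolding lax_orthogonal_def
proof (intro allI impI)
  fix u v assume sq: "lax_square (PMap C S) u v f g"
  obtain \<gamma> where \<gamma>: "\<gamma> \<in> Arr C" "g = lower \<gamma>" using assms(2) Tot_iff by blast
  obtain \<tau> \<sigma> \<psi> where f: "\<tau> \<in> S" "\<sigma> \<in> S" "left_adjoint C \<psi>" "\<psi> \<in> Arr C" "src C \<psi> = src C \<tau>"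
    "tgt C \<psi> = src C \<sigma>" "f = lower \<sigma> \<bullet> (lower \<psi> \<bullet> upper \<tau>)"
    using PLA_cases[OF assms(1)] .
  obtain r where r: "r \<in> Arr C" "src C r = src C \<sigma>" "tgt C r = src C \<tau>"
    "ide C (src C \<tau>) \<sqsubseteq> r \<cdot> \<psi>" "\<psi> \<cdot> r \<sqsubseteq> ide C (src C \<sigma>)"
    using f(3,5,6) by (auto simp: left_adjoint_def hom_def)
  have fst: "src (PMap C S) f = tgt C \<tau>" "tgt (PMap C S) f = tgt C \<sigma>"
    using f by simp_all
  have u: "u \<in> Arr (PMap C S)" "src (PMap C S) u = tgt C \<tau>" "tgt (PMap C S) u = src C \<gamma>"
    and v: "v \<in> Arr (PMap C S)" "src (PMap C S) v = tgt C \<sigma>" "tgt (PMap C S) v = tgt C \<gamma>"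
    and le: "lower \<gamma> \<bullet> u \<preceq> v \<bullet> f"
    using sq \<gamma> fst by (simp_all add: lax_square_def hom_def)
  \<comment> \<open>The adjoint partners of the factors of \<open>f\<close>:
    \<open>lower \<tau>\<close> for \<open>upper \<tau>\<close>, \<open>lower r\<close> for
    \<open>lower \<psi>\<close>, and \<open>upper \<sigma>\<close> for
    \<open>lower \<sigma>\<close>.\<close>
  define d where "d = u \<bullet> (lower \<tau> \<bullet> (lower r \<bullet> upper \<sigma>))"
  have d: "d \<in> hom (PMap C S) (tgt (PMap C S) f) (src (PMap C S) g)"
    unfolding d_def hom_def fst \<gamma>(2) using u f r \<gamma>(1) by simp
  \<comment> \<open>Bracketed so that \<open>upper \<tau>\<close> is split off on the right, the
    shape in which the lax square bounds the domain of \<open>u\<close> by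
    \<open>\<tau>\<close>.\<close>
  have vf: "v \<bullet> f = (v \<bullet> (lower \<sigma> \<bullet> lower \<psi>)) \<bullet> upper \<tau>"
    unfolding f(7) using f(1-6) v by simp
  have k: "v \<bullet> (lower \<sigma> \<bullet> lower \<psi>) \<in> Arr (PMap C S)"
    "src (PMap C S) (v \<bullet> (lower \<sigma> \<bullet> lower \<psi>)) = src C \<tau>"
    using f(1-6) v by simp_all
  obtain u' where u': "u' \<in> Arr (PMap C S)" "src (PMap C S) u' = src C \<tau>"
    "tgt (PMap C S) u' = tgt (PMap C S) u" "u = u' \<bullet> upper \<tau>"
    using factors_through_upper[OF u(1) k(1) f(1) \<gamma>(1) u(3) k(2) le[unfolded vf]] .
  have \<tau>\<tau>: "upper \<tau> \<bullet> (lower \<tau> \<bullet> x) = x" if "x \<in> Arr (PMap C S)" "tgt (PMap C S) x = src C \<tau>" for x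
    using P.assoc_Arr[of x "lower \<tau>" "upper \<tau>"] that f(1) upper_compose_lower[OF f(1)] by simp
  have \<sigma>\<sigma>: "upper \<sigma> \<bullet> (lower \<sigma> \<bullet> x) = x" if "x \<in> Arr (PMap C S)" "tgt (PMap C S) x = src C \<sigma>" for x
    using P.assoc_Arr[of x "lower \<sigma>" "upper \<sigma>"] that f(2) upper_compose_lower[OF f(2)] by simp
  have unit: "ide (PMap C S) (src C \<tau>) \<preceq> lower r \<bullet> lower \<psi>"
    using lower_mono[OF r(4)] lower_ide[of "src C \<tau>"] lower_compose[of \<psi> r] f(1,4-6) r(1,2) by simp
  have counit: "lower \<psi> \<bullet> lower r \<preceq> ide (PMap C S) (src C \<sigma>)"
    using lower_mono[OF r(5)] lower_ide[of "src C \<sigma>"] lower_compose[of r \<psi>] f(2,4-6) r(1,3) by simp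
  \<comment> \<open>The counit at \<open>\<tau>\<close> would bound the right side only from above;
    equality holds because \<open>u\<close> factors through \<open>upper \<tau>\<close> and
    \<open>upper \<tau> \<bullet> lower \<tau>\<close> is an identity. The unit of
    \<open>\<psi>\<close> is then inserted in the middle.\<close>
  have "u = u \<bullet> (lower \<tau> \<bullet> (ide (PMap C S) (src C \<tau>) \<bullet> upper \<tau>))"
    unfolding u'(4) using u'(1,2) f(1) by (simp add: \<tau>\<tau>)
  also have "\<dots> \<preceq> u \<bullet> (lower \<tau> \<bullet> ((lower r \<bullet> lower \<psi>) \<bullet> upper \<tau>))"
    by (intro P.leq_compose_left P.leq_compose_right unit) (use u f r in simp_all)
  also have "\<dots> = d \<bullet> f"
    unfolding d_def f(7) using u f(1-6) r(1-3) by (simp add: \<sigma>\<sigma>)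
  finally have 1: "u \<preceq> d \<bullet> f" .
  \<comment> \<open>After the lax square is applied, \<open>upper \<tau>\<close> from
    \<open>f\<close> cancels against \<open>lower \<tau>\<close> from \<open>d\<close>, and the
    counits of \<open>\<psi>\<close> and \<open>\<sigma>\<close> remove the rest.\<close>
  have "g \<bullet> d = (lower \<gamma> \<bullet> u) \<bullet> (lower \<tau> \<bullet> (lower r \<bullet> upper \<sigma>))"
    unfolding d_def \<gamma>(2) using u f(1-6) r(1-3) \<gamma>(1) by simp
  also have "\<dots> \<preceq> (v \<bullet> f) \<bullet> (lower \<tau> \<bullet> (lower r \<bullet> upper \<sigma>))"
    by (intro P.leq_compose_right le) (use u f(1-6) r(1-3) \<gamma>(1) in simp_all)
  also have "\<dots> = v \<bullet> (lower \<sigma> \<bullet> ((lower \<psi> \<bullet> lower r) \<bullet> upper \<sigma>))"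
    unfolding f(7) using v f(1-6) r(1-3) by (simp add: \<tau>\<tau>)
  also have "\<dots> \<preceq> v \<bullet> (lower \<sigma> \<bullet> (ide (PMap C S) (src C \<sigma>) \<bullet> upper \<sigma>))"
    by (intro P.leq_compose_left P.leq_compose_right counit) (use v f(1-6) r(1-3) in simp_all)
  also have "\<dots> = v \<bullet> (lower \<sigma> \<bullet> upper \<sigma>)"
    using f(2) by simp
  also have "\<dots> \<preceq> v \<bullet> ide (PMap C S) (tgt C \<sigma>)"
    by (intro P.leq_compose_left lower_compose_upper_le) (use v f(2) in simp_all)
  also have "\<dots> = v" using v by simp
  finally have 2: "g \<bullet> d \<preceq> v" .
  show "\<exists>d \<in> hom (PMap C S) (tgt (PMap C S) f) (src (PMap C S) g). u \<preceq> d \<bullet> f \<and> g \<bullet> d \<preceq> v"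
    using d 1 2 by blast
qed

text \<open>A diagonal bounds the identity by a map that factors through
  \<open>upper \<sigma>\<close>. The domain of the identity is everything, so
  \<open>\<sigma>\<close> acquires a section, and a monic with a section is invertible.\<close>

lemma Tot_if_lax_orthogonal:
  assumes "(\<sigma>, \<phi>) \<in> spans C S" "lax_orthogonal (PMap C S) (upper \<sigma>) (pmap C S \<sigma> \<phi>)"
  shows "pmap C S \<sigma> \<phi> \<in> Tot C S"
proof -
  note st = PMap_src_tgt[OF assms(1)]
  have sp: "\<sigma> \<in> S" "\<phi> \<in> Arr C" "src C \<sigma> = src C \<phi>" using assms(1) by (simp_all add: spans_iff)
  \<comment> \<open>The test square has the identity on top and \<open>lower \<phi>\<close> at the
    bottom; it commutes because both composites are the given partial map.\<close>
  have "pmap C S \<sigma> \<phi> \<bullet> ide (PMap C S) (tgt C \<sigma>) = lower \<phi> \<bullet> upper \<sigma>"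
    using lower_compose_upper[OF sp] st pmap_Arr[OF assms(1)] by simp
  moreover have "\<dots> \<preceq> \<dots>" by (rule P.leq_refl) (use sp in simp)
  ultimately have "lax_square (PMap C S) (ide (PMap C S) (tgt C \<sigma>)) (lower \<phi>) (upper \<sigma>) (pmap C S \<sigma> \<phi>)"
    using sp pmap_Arr[OF assms(1)] st by (simp add: lax_square_def hom_def)
  then obtain d where d: "d \<in> hom (PMap C S) (src C \<sigma>) (tgt C \<sigma>)"
    "ide (PMap C S) (tgt C \<sigma>) \<preceq> d \<bullet> upper \<sigma>"
    using assms(2) sp st unfolding lax_orthogonal_def by auto
  obtain \<delta> \<epsilon> where e: "\<delta> \<in> S" "\<epsilon> \<in> Arr C" "src C \<delta> = src C \<epsilon>" "d = pmap C S \<delta> \<epsilon>"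
    "tgt C \<delta> = src C \<sigma>" "tgt C \<epsilon> = tgt C \<sigma>" "(\<delta>, \<epsilon>) \<in> spans C S"
    using PMap_hom_cases[OF d(1)] .
  have s1: "(ide C (tgt C \<sigma>), ide C (tgt C \<sigma>)) \<in> spans C S" and s2: "(\<sigma> \<cdot> \<delta>, \<epsilon>) \<in> spans C S"
    using sp e by (simp_all add: spans_iff S_compose)
  have "pmap C S (ide C (tgt C \<sigma>)) (ide C (tgt C \<sigma>)) \<preceq> pmap C S (\<sigma> \<cdot> \<delta>) \<epsilon>"
    using d(2) pmap_compose_upper[OF e(7) sp(1)] e(4,5) by (simp add: PMap_ide)
  then obtain s where s: "s \<in> Arr C" "src C s = src C (ide C (tgt C \<sigma>))" "tgt C s = src C (\<sigma> \<cdot> \<delta>)"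
    "ide C (tgt C \<sigma>) = (\<sigma> \<cdot> \<delta>) \<cdot> s"
    unfolding PMap_leq_iff[OF s1 s2] by blast
  have s': "src C s = tgt C \<sigma>" "tgt C s = src C \<delta>"
    using s(2,3) sp e(1,5) by simp_all
  have \<sigma>\<delta>s: "\<sigma> \<cdot> (\<delta> \<cdot> s) = ide C (tgt C \<sigma>)"
    unfolding s(4) using s(1) s' sp(1) e(1,5) by simp
  \<comment> \<open>The section \<open>\<delta> \<cdot> s\<close> of \<open>\<sigma>\<close> is also
    a left inverse, by cancelling the monic \<open>\<sigma>\<close>.\<close>
  have "\<sigma> \<cdot> ((\<delta> \<cdot> s) \<cdot> \<sigma>) = (\<sigma> \<cdot> (\<delta> \<cdot> s)) \<cdot> \<sigma>"
    using s(1) s' sp(1) e(1,5) by simp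
  also have "\<dots> = \<sigma> \<cdot> ide C (src C \<sigma>)"
    unfolding \<sigma>\<delta>s using sp(1) by simp
  finally have \<delta>s\<sigma>: "(\<delta> \<cdot> s) \<cdot> \<sigma> = ide C (src C \<sigma>)"
    by (rule S_monicD[OF sp(1)]) (use s(1) s' sp(1) e(1,5) in simp_all)
  have "iso C \<sigma>"
    by (rule isoI[OF _ _ _ _ \<delta>s\<sigma>]) (use s(1) s' \<sigma>\<delta>s sp(1) e(1,5) in simp_all)
  then show ?thesis
    using pmap_self[OF assms(1)] pmap_Arr[OF assms(1)] unfolding Tot_def by blast
qed

text \<open>The diagonal \<open>d\<close> supplies both missing data: its domain inclusion
  \<open>\<delta>\<close> is the \<open>S\<close>-part of \<open>\<phi>\<close>, and its right leg
  \<open>\<epsilon>\<close> is the right adjoint. The two inequalities for \<open>d\<close> become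
  unit and counit.\<close>

lemma PLA_if_lax_orthogonal:
  assumes "(\<sigma>, \<phi>) \<in> spans C S" "lax_orthogonal (PMap C S) (pmap C S \<sigma> \<phi>) (lower \<phi>)"
  shows "pmap C S \<sigma> \<phi> \<in> PLA C S"
proof -
  note st = PMap_src_tgt[OF assms(1)]
  have sp: "\<sigma> \<in> S" "\<phi> \<in> Arr C" "src C \<sigma> = src C \<phi>" using assms(1) by (simp_all add: spans_iff)
  \<comment> \<open>The test square has \<open>upper \<sigma>\<close> on top and the identity at the
    bottom; again both composites equal the given map.\<close>
  have "ide (PMap C S) (tgt C \<phi>) \<bullet> pmap C S \<sigma> \<phi> = lower \<phi> \<bullet> upper \<sigma>"
    using lower_compose_upper[OF sp] st pmap_Arr[OF assms(1)] by simp
  moreover have "lower \<phi> \<bullet> upper \<sigma> \<preceq> lower \<phi> \<bullet> upper \<sigma>" by (rule P.leq_refl) (use sp in simp)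
  ultimately have "lax_square (PMap C S) (upper \<sigma>) (ide (PMap C S) (tgt C \<phi>)) (pmap C S \<sigma> \<phi>) (lower \<phi>)"
    using sp pmap_Arr[OF assms(1)] st by (simp add: lax_square_def hom_def)
  then obtain d where d: "d \<in> hom (PMap C S) (tgt C \<phi>) (src C \<phi>)"
    "upper \<sigma> \<preceq> d \<bullet> pmap C S \<sigma> \<phi>" "lower \<phi> \<bullet> d \<preceq> ide (PMap C S) (tgt C \<phi>)"
    using assms(2) sp st unfolding lax_orthogonal_def by auto
  obtain \<delta> \<epsilon> where e: "\<delta> \<in> S" "\<epsilon> \<in> Arr C" "src C \<delta> = src C \<epsilon>" "d = pmap C S \<delta> \<epsilon>"
    "tgt C \<delta> = tgt C \<phi>" "tgt C \<epsilon> = src C \<phi>" "(\<delta>, \<epsilon>) \<in> spans C S"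
    using PMap_hom_cases[OF d(1)] .
  have s1: "(\<delta>, \<phi> \<cdot> \<epsilon>) \<in> spans C S" and s2: "(ide C (tgt C \<phi>), ide C (tgt C \<phi>)) \<in> spans C S"
    using sp e by (simp_all add: spans_iff)
  have "pmap C S \<delta> (\<phi> \<cdot> \<epsilon>) \<preceq> pmap C S (ide C (tgt C \<phi>)) (ide C (tgt C \<phi>))"
    using d(3) lower_compose_pmap[OF e(7) sp(2)] e(4,6) by (simp add: PMap_ide)
  then obtain s where "s \<in> Arr C" "tgt C s = src C (ide C (tgt C \<phi>))"
    "\<delta> = ide C (tgt C \<phi>) \<cdot> s" "\<phi> \<cdot> \<epsilon> \<sqsubseteq> ide C (tgt C \<phi>) \<cdot> s"
    unfolding PMap_leq_iff[OF s1 s2] by blast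
  \<comment> \<open>The inclusion into the full domain of the identity can only be
    \<open>\<delta>\<close> itself, so the lower triangle reduces to one inequality in
    \<open>C\<close>.\<close>
  then have le1: "\<phi> \<cdot> \<epsilon> \<sqsubseteq> \<delta>" by metis
  obtain p q where P: "is_pullback C \<phi> \<delta> p q"
    using S_has_pullbacks[OF e(1) sp(2)] e(5) by auto
  note D = pullbackD[OF P]
  note comp = PMap_compose[OF assms(1) e(7) P]
  have "pmap C S \<sigma> (ide C (src C \<sigma>)) \<preceq> pmap C S (\<sigma> \<cdot> p) (\<epsilon> \<cdot> q)"
    using d(2) comp(1) e(4) by (simp add: upper_def)
  then obtain t where t: "t \<in> Arr C" "src C t = src C \<sigma>" "tgt C t = src C (\<sigma> \<cdot> p)"
    "\<sigma> = (\<sigma> \<cdot> p) \<cdot> t" "ide C (src C \<sigma>) \<sqsubseteq> (\<epsilon> \<cdot> q) \<cdot> t"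
    unfolding PMap_leq_iff[OF upper_span[OF sp(1)] comp(2)] by blast
  have t': "tgt C t = src C p" using t(3) sp D by simp
  \<comment> \<open>The upper triangle says that \<open>\<phi>\<close> carries all of its domain
    into the domain of \<open>d\<close>: the pullback \<open>p\<close> of \<open>\<delta>\<close>
    along \<open>\<phi>\<close> has the section \<open>t\<close>.\<close>
  have "\<sigma> \<cdot> (p \<cdot> t) = (\<sigma> \<cdot> p) \<cdot> t" using t(1) t' sp(1,3) D by simp
  also have "\<dots> = \<sigma> \<cdot> ide C (src C \<sigma>)" using t(4) sp(1) by simp
  finally have pt: "p \<cdot> t = ide C (src C \<sigma>)"
    by (rule S_monicD[OF sp(1)]) (use t(1,2) t' sp(1,3) D in simp_all)
  \<comment> \<open>The section followed by the other leg of the pullback is the corestriction of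
    \<open>\<phi>\<close> along \<open>\<delta>\<close>.\<close>
  define \<psi> where "\<psi> = q \<cdot> t"
  have \<psi>: "\<psi> \<in> Arr C" "src C \<psi> = src C \<sigma>" "tgt C \<psi> = src C \<delta>"
    unfolding \<psi>_def using t(1,2) t' D by simp_all
  have "\<delta> \<cdot> \<psi> = \<phi> \<cdot> (p \<cdot> t)"
    unfolding \<psi>_def by (rule sym, rule compose_eq_extend[OF D(9)]) (use t(1) t' D in simp_all)
  then have \<phi>: "\<phi> = \<delta> \<cdot> \<psi>" unfolding pt using sp(2,3) by simp
  have unit: "ide C (src C \<sigma>) \<sqsubseteq> \<epsilon> \<cdot> \<psi>"
    using t(5) unfolding \<psi>_def using t(1) t' D e(2,3) by simp
  \<comment> \<open>The counit is obtained after composing with \<open>\<delta>\<close>, where it is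
    \<open>le1\<close>, and fullness of \<open>\<delta>\<close> cancels this composition.\<close>
  have "\<delta> \<cdot> (\<psi> \<cdot> \<epsilon>) \<sqsubseteq> \<delta> \<cdot> ide C (src C \<delta>)"
  proof -
    have "\<delta> \<cdot> (\<psi> \<cdot> \<epsilon>) = (\<delta> \<cdot> \<psi>) \<cdot> \<epsilon>" using \<psi> e(1,2,6) sp(3) by simp
    also have "\<dots> = \<phi> \<cdot> \<epsilon>" by (simp only: \<phi>[symmetric])
    finally show ?thesis using le1 e(1) by simp
  qed
  moreover have "\<psi> \<cdot> \<epsilon> \<in> hom C (src C \<delta>) (src C \<delta>)" "ide C (src C \<delta>) \<in> hom C (src C \<delta>) (src C \<delta>)"
    using \<psi> e(1-3,6) sp(3) by (simp_all add: hom_def)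
  ultimately have counit: "\<psi> \<cdot> \<epsilon> \<sqsubseteq> ide C (src C \<delta>)"
    using S_full[OF e(1)] by blast
  have "\<epsilon> \<in> hom C (tgt C \<psi>) (src C \<psi>)" using e(2,3,6) \<psi> sp(3) by (simp add: hom_def)
  then have "left_adjoint C \<psi>"
    unfolding left_adjoint_def using unit counit \<psi> by auto
  then show ?thesis using PLA_I[OF sp(1) e(1)] \<psi>(2,3) \<phi> by simp
qed

end


section \<open>The functorial factorisation\<close>

locale partial_maps_rep = partial_maps C S
  for C :: "('o, 'm) ocat" (structure) and S :: "'m set" +
  fixes rep :: "('m \<times> 'm) set \<Rightarrow> 'm \<times> 'm"
  assumes rep_mem: "f \<in> Arr (PMap C S) \<Longrightarrow> rep f \<in> f"
begin

lemma repD: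
  assumes "f \<in> Arr (PMap C S)" "rep f = (\<sigma>, \<phi>)"
  shows "\<sigma> \<in> S" "\<phi> \<in> Arr C" "src C \<sigma> = src C \<phi>" "f = pmap C S \<sigma> \<phi>" "(\<sigma>, \<phi>) \<in> spans C S"
    "pK C rep f = src C \<sigma>" "pL C S rep f = upper \<sigma>" "pR C S rep f = lower \<phi>"
proof -
  have "(\<sigma>, \<phi>) \<in> f" using rep_mem[OF assms(1)] assms(2) by simp
  note sp = pmap_of_mem[OF assms(1) this]
  show sp': "\<sigma> \<in> S" "\<phi> \<in> Arr C" "src C \<sigma> = src C \<phi>" using sp(1) by (simp_all add: spans_iff)
  show "f = pmap C S \<sigma> \<phi>" "(\<sigma>, \<phi>) \<in> spans C S" using sp(2,1) .
  show "pK C rep f = src C \<sigma>" "pL C S rep f = upper \<sigma>" "pR C S rep f = lower \<phi>"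
    using assms(2) sp'(3) by (simp_all add: pK_def pL_def pR_def upper_def lower_def)
qed

text \<open>\<open>pKm\<close> ranges over all representatives, pullbacks and witnesses; here it is
  seen to be the class of one span, with the laws needed later. The key is that
  \<open>g \<bullet> u\<close> and \<open>upper \<sigma>g \<bullet> u\<close> have the same domain,
  both being computed from the pullback of \<open>\<phi>u\<close> and
  \<open>\<sigma>g\<close>.\<close>

lemma pKm_pmap:
  assumes sq: "lax_square (PMap C S) u v f g"
    and rf: "rep f = (\<sigma>f, \<phi>f)" and rg: "rep g = (\<sigma>g, \<phi>g)"
  obtains a q where "(a, q) \<in> spans C S" "tgt C a = src C \<sigma>f" "tgt C q = src C \<sigma>g"
    "pKm C S rep f g u v = pmap C S a q"
    "pmap C S (\<sigma>f \<cdot> a) q = upper \<sigma>g \<bullet> u" "lower \<phi>g \<bullet> pmap C S a q \<preceq> v \<bullet> lower \<phi>f"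
proof -
  have arr: "f \<in> Arr (PMap C S)" "g \<in> Arr (PMap C S)" "u \<in> Arr (PMap C S)" "v \<in> Arr (PMap C S)"
    "src (PMap C S) u = src (PMap C S) f" "tgt (PMap C S) u = src (PMap C S) g"
    "src (PMap C S) v = tgt (PMap C S) f" "tgt (PMap C S) v = tgt (PMap C S) g"
    and le: "g \<bullet> u \<preceq> v \<bullet> f"
    using sq by (simp_all add: lax_square_def hom_def)
  note f = repD[OF arr(1) rf] and g = repD[OF arr(2) rg]
  obtain \<sigma>u \<phi>u where u: "\<sigma>u \<in> S" "\<phi>u \<in> Arr C" "src C \<sigma>u = src C \<phi>u" "u = pmap C S \<sigma>u \<phi>u"
    using pmap_cases[OF arr(3)] .
  obtain \<sigma>v \<phi>v where v: "\<sigma>v \<in> S" "\<phi>v \<in> Arr C" "src C \<sigma>v = src C \<phi>v" "v = pmap C S \<sigma>v \<phi>v"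
    using pmap_cases[OF arr(4)] .
  have su: "(\<sigma>u, \<phi>u) \<in> spans C S" and sv: "(\<sigma>v, \<phi>v) \<in> spans C S"
    using u v by (simp_all add: spans_iff)
  have t: "tgt C \<phi>u = tgt C \<sigma>g" "tgt C \<phi>f = tgt C \<sigma>v"
    using arr(6,7) PMap_src_tgt[OF su] PMap_src_tgt[OF sv] PMap_src_tgt[OF f(5)] PMap_src_tgt[OF g(5)]
      f(4) g(4) u(4) v(4) by simp_all
  obtain p q where P: "is_pullback C \<phi>u \<sigma>g p q"
    using S_has_pullbacks[OF g(1) u(2) t(1)] by auto
  obtain p' q' where P': "is_pullback C \<phi>f \<sigma>v p' q'"
    using S_has_pullbacks[OF v(1) f(2) t(2)] by auto
  note D = pullbackD[OF P] and D' = pullbackD[OF P']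
  have pS: "p \<in> S" "p' \<in> S" using S_stable[OF g(1) P] S_stable[OF v(1) P'] .
  note gu = PMap_compose[OF su g(5) P] and vf = PMap_compose[OF f(5) sv P']
  have "pmap C S (\<sigma>u \<cdot> p) (\<phi>g \<cdot> q) \<preceq> pmap C S (\<sigma>f \<cdot> p') (\<phi>v \<cdot> q')"
    using le gu(1) vf(1) by (simp add: f(4) g(4) u(4) v(4))
  then obtain s where s: "s \<in> Arr C" "src C s = src C (\<sigma>u \<cdot> p)" "tgt C s = src C (\<sigma>f \<cdot> p')"
    "\<sigma>u \<cdot> p = (\<sigma>f \<cdot> p') \<cdot> s" "\<phi>g \<cdot> q \<sqsubseteq> (\<phi>v \<cdot> q') \<cdot> s"
    unfolding PMap_leq_iff[OF gu(2) vf(2)] by blast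
  have s': "src C s = src C p" "tgt C s = src C p'"
    using s(2,3) D(4,7) D'(4,7) u(1,3) f(1,3) by simp_all
  have "\<sigma>f \<cdot> p' \<in> S" "\<sigma>u \<cdot> p \<in> S"
    using pS f(1,3) u(1,3) D(7) D'(7) by (simp_all add: S_compose)
  then have sS: "s \<in> S" using S_cancel[OF _ _ s(1,3)] s(4) by simp
  define a where "a = p' \<cdot> s"
  have aS: "a \<in> S" unfolding a_def using sS pS s'(2) by (simp add: S_compose)
  have a: "src C a = src C p" "tgt C a = src C \<sigma>f"
    unfolding a_def using s(1) s' D'(4,7) f(3) by simp_all
  have sa: "(a, q) \<in> spans C S" using aS a D(5,6) by (simp add: spans_iff)
  have \<sigma>a: "\<sigma>u \<cdot> p = \<sigma>f \<cdot> a"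
    unfolding a_def s(4) using s(1) s'(2) D'(4,7) f(1,3) by simp
  \<comment> \<open>Stated for arbitrary representatives, since it is applied to the fixed span of
    \<open>u\<close> and again to the varying ones in the description of \<open>pKm\<close>.\<close>
  have upper_u: "upper \<sigma>g \<bullet> pmap C S \<sigma>1 \<phi>1 = pmap C S (\<sigma>1 \<cdot> p1) q1"
    and span_u: "(\<sigma>1 \<cdot> p1, q1) \<in> spans C S"
    if "(\<sigma>1, \<phi>1) \<in> spans C S" "is_pullback C \<phi>1 \<sigma>g p1 q1" for \<sigma>1 \<phi>1 p1 q1
    using PMap_compose[OF that(1) upper_span[OF g(1)] that(2)] pullbackD[OF that(2)]
    by (simp_all add: upper_def)
  have Lu: "pmap C S (\<sigma>f \<cdot> a) q = upper \<sigma>g \<bullet> u"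
    using upper_u[OF su P] \<sigma>a u(4) by simp
  \<comment> \<open>The witness \<open>s\<close> of the given inequality serves again:
    \<open>a\<close> is \<open>p' \<cdot> s\<close> by definition, and the condition on right legs
    is the same.\<close>
  have "pmap C S a (\<phi>g \<cdot> q) \<preceq> pmap C S p' (\<phi>v \<cdot> q')"
  proof -
    have 1: "(a, \<phi>g \<cdot> q) \<in> spans C S" "(p', \<phi>v \<cdot> q') \<in> spans C S"
      using aS a D(5,6,8) D'(5,6,8) pS g(2,3) v(2,3) by (simp_all add: spans_iff)
    show ?thesis
      unfolding PMap_leq_iff[OF 1] using s(1,5) s' a(1) a_def by auto
  qed
  moreover have "v \<bullet> lower \<phi>f = pmap C S p' (\<phi>v \<cdot> q')"
    using PMap_compose(1)[OF lower_span[OF f(2)] sv P'] v(4) D'(4,7) by (simp add: lower_def)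
  moreover have "lower \<phi>g \<bullet> pmap C S a q = pmap C S a (\<phi>g \<cdot> q)"
    using lower_compose_pmap[OF sa g(2)] D(8) g(3) by simp
  ultimately have R: "lower \<phi>g \<bullet> pmap C S a q \<preceq> v \<bullet> lower \<phi>f" by simp
  have "x \<in> pKm C S rep f g u v \<longleftrightarrow> x \<in> pmap C S a q" for x
  proof
    assume "x \<in> pKm C S rep f g u v"
    then obtain p1' s1 q1 p1 q1' \<sigma>1 \<phi>1 \<sigma>2 \<phi>2 where x: "x = (p1' \<cdot> s1, q1)" "(\<sigma>1, \<phi>1) \<in> u"
      "is_pullback C \<phi>1 \<sigma>g p1 q1" "is_pullback C \<phi>f \<sigma>2 p1' q1'"
      "s1 \<in> S" "s1 \<in> hom C (src C p1) (src C p1')" "\<sigma>1 \<cdot> p1 = (\<sigma>f \<cdot> p1') \<cdot> s1"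
      unfolding pKm_def rf rg by auto
    note E = pullbackD[OF x(3)] and E' = pullbackD[OF x(4)]
    have s1: "s1 \<in> Arr C" "src C s1 = src C p1" "tgt C s1 = src C p1'"
      using x(6) by (simp_all add: hom_def)
    note u1 = pmap_of_mem[OF arr(3) x(2)]
    \<comment> \<open>Any other choice of data gives another representative of
      \<open>upper \<sigma>g \<bullet> u\<close>, hence an isomorphism \<open>i\<close> to the fixed
      one; cancelling the monic \<open>\<sigma>f\<close> shows that \<open>i\<close> relates the
      left legs of \<open>pKm\<close> as well.\<close>
    have "pmap C S (\<sigma>f \<cdot> a) q = pmap C S (\<sigma>1 \<cdot> p1) q1"
      using Lu upper_u[OF u1(1) x(3)] u1(2) by simp
    moreover have "(\<sigma>f \<cdot> a, q) \<in> spans C S" using span_u[OF su P] \<sigma>a by simp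
    ultimately obtain i where i: "iso C i" "tgt C i = src C (\<sigma>f \<cdot> a)" "\<sigma>1 \<cdot> p1 = (\<sigma>f \<cdot> a) \<cdot> i" "q1 = q \<cdot> i"
      using pmap_eqD[OF _ span_u[OF u1(1) x(3)]] by metis
    have i': "tgt C i = src C a" using i(2) a aS f(1) by simp
    have "\<sigma>f \<cdot> (p1' \<cdot> s1) = (\<sigma>f \<cdot> p1') \<cdot> s1" using s1 E'(4,7) f(1,3) by simp
    also have "\<dots> = (\<sigma>f \<cdot> a) \<cdot> i" using x(7) i(3) by simp
    also have "\<dots> = \<sigma>f \<cdot> (a \<cdot> i)" using i(1) i' a(2) aS f(1) by simp
    finally have eq: "\<sigma>f \<cdot> (p1' \<cdot> s1) = \<sigma>f \<cdot> (a \<cdot> i)" .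
    have "src C (q \<cdot> i) = src C p1" using E(6) i(4) by simp
    then have "src C i = src C p1" using i(1) i' a(1) D(5,6) by simp
    then have "p1' \<cdot> s1 = a \<cdot> i"
      by (intro S_monicD[OF f(1) eq]) (use s1 E'(4,7) f(3) i(1) i' a(2) aS in simp_all)
    then show "x \<in> pmap C S a q"
      using mem_pmap_iff[OF sa] i(1,4) i' x(1) by auto
  next
    assume "x \<in> pmap C S a q"
    then obtain i where i: "iso C i" "tgt C i = src C p" "x = (a \<cdot> i, q \<cdot> i)"
      using mem_pmap_iff[OF sa] a(1) by auto
    \<comment> \<open>Conversely, \<open>i\<close> is absorbed into the pullback
      \<open>(p, q)\<close> and the witness \<open>s\<close>, while the other pullback stays
      fixed.\<close>
    have "x = (p' \<cdot> (s \<cdot> i), q \<cdot> i)"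
      using i s(1) s' D'(4) by (simp add: a_def)
    moreover have "(\<sigma>u, \<phi>u) \<in> u" "(\<sigma>v, \<phi>v) \<in> v"
      using pmap_self[OF su] pmap_self[OF sv] u(4) v(4) by simp_all
    moreover have "is_pullback C \<phi>u \<sigma>g (p \<cdot> i) (q \<cdot> i)"
      using pullback_compose_iso[OF P i(1,2)] .
    moreover have "s \<cdot> i \<in> S" "s \<cdot> i \<in> hom C (src C (p \<cdot> i)) (src C p')"
      using i(1,2) s(1) s' sS D(4) by (simp_all add: S_compose hom_def)
    moreover have "\<sigma>u \<cdot> (p \<cdot> i) = (\<sigma>f \<cdot> p') \<cdot> (s \<cdot> i)"
      by (rule compose_eq_extend[OF s(4)])
        (use i(1,2) s(1,3) s' D(4,7) D'(4,7) u(1,3) f(1,3) in simp_all)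
    moreover have "\<phi>g \<cdot> (q \<cdot> i) \<sqsubseteq> (\<phi>v \<cdot> q') \<cdot> (s \<cdot> i)"
    proof -
      have "(\<phi>g \<cdot> q) \<cdot> i \<sqsubseteq> ((\<phi>v \<cdot> q') \<cdot> s) \<cdot> i"
        by (rule leq_compose_right[OF s(5)]) (use i(1,2) D(5,6,8) g(2,3) in simp_all)
      moreover have "(\<phi>g \<cdot> q) \<cdot> i = \<phi>g \<cdot> (q \<cdot> i)" using i(1,2) D(5,6,8) g(2,3) by simp
      moreover have "((\<phi>v \<cdot> q') \<cdot> s) \<cdot> i = (\<phi>v \<cdot> q') \<cdot> (s \<cdot> i)"
        using i(1,2) s(1) s' D'(5,6,8) v(2,3) by simp
      ultimately show ?thesis by simp
    qed
    ultimately show "x \<in> pKm C S rep f g u v"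
      unfolding pKm_def rf rg using P' by fastforce
  qed
  then have "pKm C S rep f g u v = pmap C S a q" by blast
  then show ?thesis using that[OF sa a(2) D(8) _ Lu R] by blast
qed

text \<open>Representative-free form of the preceding description. The left square holds with
  equality, not just laxly, and this equation is what pins down \<open>pKm\<close>.\<close>

lemma
  assumes "lax_square (PMap C S) u v f g"
  shows pKm_hom: "pKm C S rep f g u v \<in> hom (PMap C S) (pK C rep f) (pK C rep g)"
    and pKm_compose_pL: "pKm C S rep f g u v \<bullet> pL C S rep f = pL C S rep g \<bullet> u"
    and pR_compose_pKm: "pR C S rep g \<bullet> pKm C S rep f g u v \<preceq> v \<bullet> pR C S rep f"
proof -
  have arr: "f \<in> Arr (PMap C S)" "g \<in> Arr (PMap C S)"
    using assms by (simp_all add: lax_square_def)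
  obtain \<sigma>f \<phi>f \<sigma>g \<phi>g where r: "rep f = (\<sigma>f, \<phi>f)" "rep g = (\<sigma>g, \<phi>g)" by fastforce
  note f = repD[OF arr(1) r(1)] and g = repD[OF arr(2) r(2)]
  obtain a q where a: "(a, q) \<in> spans C S" "tgt C a = src C \<sigma>f" "tgt C q = src C \<sigma>g"
    "pKm C S rep f g u v = pmap C S a q"
    "pmap C S (\<sigma>f \<cdot> a) q = upper \<sigma>g \<bullet> u" "lower \<phi>g \<bullet> pmap C S a q \<preceq> v \<bullet> lower \<phi>f"
    using pKm_pmap[OF assms r] .
  show "pKm C S rep f g u v \<in> hom (PMap C S) (pK C rep f) (pK C rep g)"
    using a(1-4) f(6) g(6) by (simp add: pmap_hom_iff)
  show "pKm C S rep f g u v \<bullet> pL C S rep f = pL C S rep g \<bullet> u"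
    using pmap_compose_upper[OF a(1) f(1)] a(2,4,5) f(7) g(7) by simp
  show "pR C S rep g \<bullet> pKm C S rep f g u v \<preceq> v \<bullet> pR C S rep f"
    using a(4,6) f(8) g(8) by simp
qed

lemma
  assumes "f \<in> Arr (PMap C S)"
  shows pL_hom: "pL C S rep f \<in> hom (PMap C S) (src (PMap C S) f) (pK C rep f)"
    and pR_hom: "pR C S rep f \<in> hom (PMap C S) (pK C rep f) (tgt (PMap C S) f)"
    and pR_compose_pL: "pR C S rep f \<bullet> pL C S rep f = f"
    and pL_PLA: "pL C S rep f \<in> PLA C S"
    and pR_Tot: "pR C S rep f \<in> Tot C S"
proof -
  obtain \<sigma> \<phi> where r: "rep f = (\<sigma>, \<phi>)" by fastforce
  note f = repD[OF assms r]
  note st = PMap_src_tgt[OF f(5), folded f(4)]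
  show "pL C S rep f \<in> hom (PMap C S) (src (PMap C S) f) (pK C rep f)"
    "pR C S rep f \<in> hom (PMap C S) (pK C rep f) (tgt (PMap C S) f)"
    using f(1-3,6-8) st by (simp_all add: hom_def)
  show "pR C S rep f \<bullet> pL C S rep f = f"
    using f(7,8) lower_compose_upper[OF f(1-3), folded f(4)] by simp
  show "pL C S rep f \<in> PLA C S" "pR C S rep f \<in> Tot C S"
    using f(2,7,8) upper_PLA[OF f(1)] Tot_iff by auto
qed

text \<open>\<open>lower \<sigma>\<close> is a section of \<open>upper \<sigma>\<close>, so
  composing both sides with it recovers \<open>x\<close> and \<open>y\<close>.\<close>

lemma pL_cancel:
  assumes "f \<in> Arr (PMap C S)" "x \<in> hom (PMap C S) (pK C rep f) B" "y \<in> hom (PMap C S) (pK C rep f) B"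
    "x \<bullet> pL C S rep f = y \<bullet> pL C S rep f"
  shows "x = y"
proof -
  obtain \<sigma> \<phi> where "rep f = (\<sigma>, \<phi>)" by fastforce
  note \<sigma> = repD(1,6,7)[OF assms(1) this]
  have *: "(z \<bullet> upper \<sigma>) \<bullet> lower \<sigma> = z" if "z \<in> hom (PMap C S) (pK C rep f) B" for z
    using that \<sigma> upper_compose_lower[OF \<sigma>(1)] by (simp add: hom_def)
  show ?thesis
    using *[OF assms(2)] *[OF assms(3)] assms(4) unfolding \<sigma>(3) by metis
qed

section \<open>Functoriality and the weak factorisation system\<close>

lemma lax_square_compose:
  assumes "lax_square (PMap C S) u v f g" "lax_square (PMap C S) u' v' g h"
  shows "lax_square (PMap C S) (u' \<bullet> u) (v' \<bullet> v) f h"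
proof -
  have 1: "f \<in> Arr (PMap C S)" "g \<in> Arr (PMap C S)" "h \<in> Arr (PMap C S)"
    "u \<in> Arr (PMap C S)" "src (PMap C S) u = src (PMap C S) f" "tgt (PMap C S) u = src (PMap C S) g"
    "v \<in> Arr (PMap C S)" "src (PMap C S) v = tgt (PMap C S) f" "tgt (PMap C S) v = tgt (PMap C S) g"
    "u' \<in> Arr (PMap C S)" "src (PMap C S) u' = src (PMap C S) g" "tgt (PMap C S) u' = src (PMap C S) h"
    "v' \<in> Arr (PMap C S)" "src (PMap C S) v' = tgt (PMap C S) g" "tgt (PMap C S) v' = tgt (PMap C S) h"
    and le: "g \<bullet> u \<preceq> v \<bullet> f" "h \<bullet> u' \<preceq> v' \<bullet> g"
    using assms by (simp_all add: lax_square_def hom_def)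
  have "h \<bullet> (u' \<bullet> u) = (h \<bullet> u') \<bullet> u" using 1 by simp
  also have "\<dots> \<preceq> (v' \<bullet> g) \<bullet> u"
    by (rule P.leq_compose_right[OF le(2)]) (use 1 in simp_all)
  also have "\<dots> = v' \<bullet> (g \<bullet> u)" using 1 by simp
  also have "\<dots> \<preceq> v' \<bullet> (v \<bullet> f)"
    by (rule P.leq_compose_left[OF le(1)]) (use 1 in simp_all)
  also have "\<dots> = (v' \<bullet> v) \<bullet> f" using 1 by simp
  finally show ?thesis using 1 by (simp add: lax_square_def hom_def)
qed

lemma lax_functorial_factorisation_system_PMap:
  "lax_functorial_factorisation_system (PMap C S) (pK C rep) (pL C S rep) (pR C S rep) (pKm C S rep)"
proof unfold_locales
  fix f g u v assume sq: "lax_square (PMap C S) u v f g"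
  show "pKm C S rep f g u v \<in> hom (PMap C S) (pK C rep f) (pK C rep g)"
    "pR C S rep g \<bullet> pKm C S rep f g u v \<preceq> v \<bullet> pR C S rep f"
    using pKm_hom[OF sq] pR_compose_pKm[OF sq] .
  have "g \<in> Arr (PMap C S)" "u \<in> hom (PMap C S) (src (PMap C S) f) (src (PMap C S) g)"
    using sq by (simp_all add: lax_square_def)
  then have "pL C S rep g \<bullet> u \<in> Arr (PMap C S)"
    using pL_hom by (simp add: hom_def)
  then show "pL C S rep g \<bullet> u \<preceq> pKm C S rep f g u v \<bullet> pL C S rep f"
    using pKm_compose_pL[OF sq] P.leq_refl by simp
  fix h u' v' assume sq': "lax_square (PMap C S) u' v' g h"
  note sq'' = lax_square_compose[OF sq sq']
  have u: "f \<in> Arr (PMap C S)" "g \<in> Arr (PMap C S)" "h \<in> Arr (PMap C S)"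
    "u \<in> hom (PMap C S) (src (PMap C S) f) (src (PMap C S) g)"
    "u' \<in> hom (PMap C S) (src (PMap C S) g) (src (PMap C S) h)"
    using sq sq' by (simp_all add: lax_square_def)
  note hs = u(4,5) pL_hom[OF u(1)] pL_hom[OF u(2)] pL_hom[OF u(3)] pKm_hom[OF sq] pKm_hom[OF sq']
  note hs' = hs[unfolded hom_def mem_Collect_eq]
  let ?K = "pKm C S rep f g u v" and ?K' = "pKm C S rep g h u' v'"
  \<comment> \<open>Both sides of the composition law are compared after precomposing with
    \<open>pL C S rep f\<close>, where \<open>pKm_compose_pL\<close> moves each \<open>K\<close>
    across until only \<open>u' \<bullet> u\<close> remains.\<close>
  have "(?K' \<bullet> ?K) \<bullet> pL C S rep f = ?K' \<bullet> (?K \<bullet> pL C S rep f)"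
    using hs' by simp
  also have "\<dots> = (?K' \<bullet> pL C S rep g) \<bullet> u"
    unfolding pKm_compose_pL[OF sq] using hs' by simp
  also have "\<dots> = pL C S rep h \<bullet> (u' \<bullet> u)"
    unfolding pKm_compose_pL[OF sq'] using hs' by simp
  also have "\<dots> = pKm C S rep f h (u' \<bullet> u) (v' \<bullet> v) \<bullet> pL C S rep f"
    using pKm_compose_pL[OF sq''] by simp
  finally show "pKm C S rep f h (u' \<bullet> u) (v' \<bullet> v) = ?K' \<bullet> ?K"
    using pL_cancel[OF u(1) pKm_hom[OF sq''] P.compose_hom[OF pKm_hom[OF sq] pKm_hom[OF sq']]] by simp
next
  fix f assume f: "f \<in> Arr (PMap C S)"
  show "pL C S rep f \<in> hom (PMap C S) (src (PMap C S) f) (pK C rep f)"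
    "pR C S rep f \<in> hom (PMap C S) (pK C rep f) (tgt (PMap C S) f)"
    "pR C S rep f \<bullet> pL C S rep f = f"
    using pL_hom[OF f] pR_hom[OF f] pR_compose_pL[OF f] .
  let ?a = "ide (PMap C S) (src (PMap C S) f)" and ?b = "ide (PMap C S) (tgt (PMap C S) f)"
  have sq: "lax_square (PMap C S) ?a ?b f f"
    using f P.leq_refl[OF f] P.ide_hom P.src_Obj[OF f] P.tgt_Obj[OF f]
    by (simp add: lax_square_def del: PMap_Obj)
  have L: "pL C S rep f \<in> hom (PMap C S) (src (PMap C S) f) (pK C rep f)" by (rule pL_hom[OF f])
  have "pK C rep f \<in> Obj (PMap C S)"
    using L P.tgt_Obj[of "pL C S rep f"] unfolding hom_def mem_Collect_eq by metis
  then have i: "ide (PMap C S) (pK C rep f) \<in> hom (PMap C S) (pK C rep f) (pK C rep f)"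
    by (rule P.ide_hom)
  have "pKm C S rep f f ?a ?b \<bullet> pL C S rep f = ide (PMap C S) (pK C rep f) \<bullet> pL C S rep f"
    using pKm_compose_pL[OF sq] P.ide_right[OF L] P.ide_left[OF L] by simp
  then show "pKm C S rep f f ?a ?b = ide (PMap C S) (pK C rep f)"
    by (rule pL_cancel[OF f pKm_hom[OF sq] i])
qed

text \<open>For each converse inclusion a single test suffices: \<open>g\<close> against its own
  left factor, which lies in \<open>PLA\<close>, and \<open>f\<close> against its own right factor,
  which lies in \<open>Tot\<close>.\<close>

lemma lax_weak_factorisation_system_PMap:
  "lax_weak_factorisation_system (PMap C S) (PLA C S) (Tot C S)"
proof unfold_locales
  have PLAArr: "PLA C S \<subseteq> Arr (PMap C S)" and TotArr: "Tot C S \<subseteq> Arr (PMap C S)"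
    by (auto simp: PLA_def Tot_def)
  have "g \<in> Tot C S" if g: "g \<in> Arr (PMap C S)" and "\<forall>f \<in> PLA C S. lax_orthogonal (PMap C S) f g" for g
  proof -
    obtain \<sigma> \<phi> where "rep g = (\<sigma>, \<phi>)" by fastforce
    from repD(1,4,5)[OF g this] show ?thesis using Tot_if_lax_orthogonal upper_PLA that(2) by blast
  qed
  then show "Tot C S = {g \<in> Arr (PMap C S). \<forall>f \<in> PLA C S. lax_orthogonal (PMap C S) f g}"
    using PLA_lax_orthogonal_Tot TotArr by blast
  have "f \<in> PLA C S" if f: "f \<in> Arr (PMap C S)" and "\<forall>g \<in> Tot C S. lax_orthogonal (PMap C S) f g" for f
  proof -
    obtain \<sigma> \<phi> where "rep f = (\<sigma>, \<phi>)" by fastforce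
    from repD(2,4,5)[OF f this] show ?thesis using PLA_if_lax_orthogonal Tot_iff that(2) by blast
  qed
  then show "PLA C S = {f \<in> Arr (PMap C S). \<forall>g \<in> Tot C S. lax_orthogonal (PMap C S) f g}"
    using PLA_lax_orthogonal_Tot PLAArr by blast
  fix f assume f: "f \<in> Arr (PMap C S)"
  then show "\<exists>l \<in> PLA C S. \<exists>r \<in> Tot C S. tgt (PMap C S) l = src (PMap C S) r \<and> f = r \<bullet> l"
    using pL_PLA[OF f] pR_Tot[OF f] pR_compose_pL[OF f] pL_hom[OF f] pR_hom[OF f]
    by (intro bexI[of _ "pL C S rep f"] bexI[of _ "pR C S rep f"]) (simp_all add: hom_def)
qed

end

theorem mainTheorem3:
  fixes C :: "('o, 'm) ocat"
    and S :: "'m set"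
    and rep :: "('m \<times> 'm) set \<Rightarrow> 'm \<times> 'm"
  assumes "class_of_subobjects C S"
    and "monotone_composition (PMap C S)"
    and "\<And>f. f \<in> Arr (PMap C S) \<Longrightarrow> rep f \<in> f"
  shows "lax_functorial_factorisation_system (PMap C S)
           (pK C rep) (pL C S rep) (pR C S rep) (pKm C S rep)
       \<and> predistributive (PMap C S) (pL C S rep) (pR C S rep)
       \<and> lax_weak_factorisation_system (PMap C S) (PLA C S) (Tot C S)
       \<and> underlies (PMap C S) (PLA C S) (Tot C S) (pL C S rep) (pR C S rep)"
proof -
  interpret class_of_subobjects C S by (fact assms(1))
  interpret partial_maps_rep C S rep by unfold_locales (fact assms(2), fact assms(3))
  have "pL C S rep f \<in> Arr (PMap C S)" "pR C S rep f \<in> Arr (PMap C S)"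
    if "f \<in> Arr (PMap C S)" for f
    using pL_hom[OF that] pR_hom[OF that] by (simp_all add: hom_def)
  \<comment> \<open>The factorisation may be applied again to \<open>pL C S rep f\<close> and
    \<open>pR C S rep f\<close>, so each required pair consists of a member of \<open>PLA\<close>
    and a member of \<open>Tot\<close>.\<close>
  then have "predistributive (PMap C S) (pL C S rep) (pR C S rep)"
    unfolding predistributive_def using pL_PLA pR_Tot PLA_lax_orthogonal_Tot by blast
  moreover have "underlies (PMap C S) (PLA C S) (Tot C S) (pL C S rep) (pR C S rep)"
    unfolding underlies_def using pL_PLA pR_Tot by blast
  ultimately show ?thesis
    using lax_functorial_factorisation_system_PMap lax_weak_factorisation_system_PMap by blast
qed

end
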